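(* If $f\in\mathrm{VMO}(\mathbb{R}^n)$ is rearrangeable, then its symmetric decreasing rearrangement satisfies $Sf\in\mathrm{VMO}(\mathbb{R}^n)$.
   Context: $|\cdot|$ is Lebesgue measure (or the Euclidean norm of a point). Cubes are open, of finite side length, with sides parallel to the axes. For a cube $Q$ and real-valued $f\in L^1(Q)$, $f_Q=\frac1{|Q|}\int_Q f$ and $\mathcal{O}(f,Q)=\frac1{|Q|}\int_Q|f-f_Q|$. $\mathrm{BMO}(\mathbb{R}^n)$ is the set of real-valued $f$ integrable on every cube with $\sup_Q\mathcal{O}(f,Q)<\infty$; $\mathrm{VMO}(\mathbb{R}^n)$ is the set of $f\in\mathrm{BMO}(\mathbb{R}^n)$ with $\lim_{\delta\to0^+}\sup_{|Q|\le\delta}\mathcal{O}(f,Q)=0$. (No vanishing at infinity is required; functions are not identified modulo constants.) For measurable $f$ on $\mathbb{R}^n$, $\mu_f(\alpha)=|\{x\in\mathbb{R}^n:|f(x)|>\alpha\}|$ for $\alpha\ge0$; $f$ is rearrangeable if $\mu_f(\alpha)\to0$ as $\alpha\to\infty$. The decreasing rearrangement is $f^*(s)=|\{\alpha\ge0:\mu_f(\alpha)>s\}|$, $s>0$, and the symmetric decreasing rearrangement is $Sf(x)=f^*(\omega_n|x|^n)$ for $x\in\mathbb{R}^n\setminus\{0\}$, where $\omega_n$ is the volume of the unit ball in $\mathbb{R}^n$. *)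

theory Defs
  imports "HOL-Analysis.Analysis"
begin

definition is_cube :: "(real^'n) set \<Rightarrow> bool" where
  "is_cube Q \<longleftrightarrow> (\<exists>a l. 0 < l \<and> Q = box a (a + (\<chi> i. l)))"

definition cube_avg :: "(real^'n \<Rightarrow> real) \<Rightarrow> (real^'n) set \<Rightarrow> real" where
  "cube_avg f Q = (LINT x:Q|lebesgue. f x) / measure lebesgue Q"

definition mean_osc :: "(real^'n \<Rightarrow> real) \<Rightarrow> (real^'n) set \<Rightarrow> real" where
  "mean_osc f Q = (LINT x:Q|lebesgue. \<bar>f x - cube_avg f Q\<bar>) / measure lebesgue Q"

text \<open>The suprema of oscillations are taken in the extended reals, so that they always exist.\<close>

definition BMO :: "(real^'n \<Rightarrow> real) set" where
  "BMO = {f. (\<forall>Q. is_cube Q \<longrightarrow> set_integrable lebesgue Q f) \<and>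
             (SUP Q\<in>{Q. is_cube Q}. ereal (mean_osc f Q)) < \<infinity>}"

definition VMO :: "(real^'n \<Rightarrow> real) set" where
  "VMO = {f \<in> BMO.
     ((\<lambda>\<delta>::real. SUP Q\<in>{Q. is_cube Q \<and> measure lebesgue Q \<le> \<delta>}. ereal (mean_osc f Q))
        \<longlongrightarrow> 0) (at_right 0)}"

definition distr_fun :: "(real^'n \<Rightarrow> real) \<Rightarrow> real \<Rightarrow> ennreal" where
  "distr_fun f \<alpha> = emeasure lebesgue {x. \<bar>f x\<bar> > \<alpha>}"

definition rearrangeable :: "(real^'n \<Rightarrow> real) \<Rightarrow> bool" where
  "rearrangeable f \<longleftrightarrow> f \<in> borel_measurable lebesgue \<and> (distr_fun f \<longlongrightarrow> 0) at_top"

text \<open>For rearrangeable \<open>f\<close> and \<open>s > 0\<close> the set below is a bounded interval, so the real-valued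
  \<^const>\<open>measure\<close> gives its length. Only arguments \<open>s > 0\<close> are meaningful.\<close>

definition decr_rearr :: "(real^'n \<Rightarrow> real) \<Rightarrow> real \<Rightarrow> real" where
  "decr_rearr f s = measure lebesgue {\<alpha>::real. 0 \<le> \<alpha> \<and> distr_fun f \<alpha> > ennreal s}"

text \<open>The symmetric decreasing rearrangement is defined away from the origin only; since the
  origin is a null set, the value \<open>0\<close> assigned there is immaterial for membership in \<open>VMO\<close>.\<close>

definition symm_rearr :: "(real^'n \<Rightarrow> real) \<Rightarrow> real^'n \<Rightarrow> real" where
  "symm_rearr f x =
     (if x = 0 then 0
      else decr_rearr f (measure lebesgue (ball (0::real^'n) 1) * norm x ^ CARD('n)))"

end

theory Submission
  imports Defs
begin

text \<open>
  Write \<open>Sf(x) = \<phi>(|x|)\<close> with \<open>\<phi>(r) = f\<^sup>*(\<omega> r\<^sup>n)\<close>. Two facts about \<open>\<phi>\<close> suffice.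
  First, \<open>\<phi>(r) - \<phi>(2r)\<close> is at most a constant times the largest oscillation of \<open>f\<close> on cubes
  of volume at most \<open>(Cr)\<^sup>n\<close>: if \<open>\<phi>(2r) < \<alpha> < \<beta> < \<phi>(r)\<close>, then \<open>{|f| > \<alpha>}\<close> is at
  most \<open>2\<^sup>n\<close> times as large as \<open>{|f| > \<beta>}\<close>, and a Vitali covering argument with balls that
  are maximal for having density \<open>\<theta>\<close> of \<open>{|f| > \<beta>}\<close> gives a ball in which both
  \<open>{|f| > \<beta>}\<close> and \<open>{|f| \<le> \<alpha>}\<close> have positive density. Second, \<open>\<phi>\<close> is continuous:
  a jump would produce arbitrarily small such balls, against vanishing mean oscillation.

  On cubes near the origin, summing the first fact over dyadic balls bounds the oscillation of \<open>Sf\<close>.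
  A small cube far from the origin may meet spheres enclosing a set of volume much larger than its
  own, but there \<open>\<phi>\<close> is uniformly continuous, being continuous, decreasing and bounded below.
\<close>

subsection \<open>Balls meeting a set and its complement\<close>

text \<open>Sparsity on the five-fold balls costs the volume ratio \<open>5 ^ DIM('a)\<close>
  relative to the disjoint small balls. Each small ball lies at least half in \<open>F\<close>, and
  disjointness lets these pieces of \<open>F\<close> be summed. The bound is uniform over finite
  subfamilies, so it passes to the countable family.\<close>

lemma measure_le_vitali:
  fixes a :: "'i \<Rightarrow> 'a::euclidean_space"
  assumes E: "E \<in> lmeasurable" and F: "F \<in> lmeasurable" and C: "countable C"
    and disj: "pairwise (\<lambda>i j. disjnt (cball (a i) (r i)) (cball (a j) (r j))) C"
    and cov: "E \<subseteq> (\<Union>i\<in>C. cball (a i) (5 * r i))"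
    and r: "\<And>i. i \<in> C \<Longrightarrow> 0 < r i" and \<theta>: "0 \<le> \<theta>"
    and sparse: "\<And>i. i \<in> C \<Longrightarrow>
      measure lebesgue (E \<inter> cball (a i) (5 * r i)) \<le> \<theta> * measure lebesgue (cball (a i) (5 * r i))"
    and half: "\<And>i. i \<in> C \<Longrightarrow>
      measure lebesgue (cball (a i) (r i)) \<le> 2 * measure lebesgue (F \<inter> cball (a i) (r i))"
  shows "measure lebesgue E \<le> 2 * \<theta> * 5 ^ DIM('a) * measure lebesgue F"
proof -
  let ?\<mu> = "measure lebesgue :: 'a set \<Rightarrow> real"
  have "?\<mu> (\<Union>i\<in>C. E \<inter> cball (a i) (5 * r i)) \<le> 2 * \<theta> * 5 ^ DIM('a) * ?\<mu> F"
  proof (rule measure_UN_bound[OF C])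
    fix I assume I: "I \<subseteq> C" "finite I"
    have "?\<mu> (\<Union>i\<in>I. E \<inter> cball (a i) (5 * r i)) \<le> (\<Sum>i\<in>I. ?\<mu> (E \<inter> cball (a i) (5 * r i)))"
      using I E by (intro measure_UNION_le) auto
    also have "\<dots> \<le> (\<Sum>i\<in>I. 2 * \<theta> * 5 ^ DIM('a) * ?\<mu> (F \<inter> cball (a i) (r i)))"
    proof (rule sum_mono)
      fix i assume "i \<in> I"
      then have i: "i \<in> C" using I by auto
      have "?\<mu> (E \<inter> cball (a i) (5 * r i)) \<le> \<theta> * ?\<mu> (cball (a i) (5 * r i))" by (rule sparse[OF i])
      also have "\<dots> = \<theta> * 5 ^ DIM('a) * ?\<mu> (cball (a i) (r i))"
        using r[OF i] by (simp add: content_cball power_mult_distrib)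
      also have "\<dots> \<le> \<theta> * 5 ^ DIM('a) * (2 * ?\<mu> (F \<inter> cball (a i) (r i)))"
        using half[OF i] \<theta> by (intro mult_left_mono) auto
      finally show "?\<mu> (E \<inter> cball (a i) (5 * r i)) \<le> 2 * \<theta> * 5 ^ DIM('a) * ?\<mu> (F \<inter> cball (a i) (r i))"
        by (simp add: mult_ac)
    qed
    also have "\<dots> = 2 * \<theta> * 5 ^ DIM('a) * ?\<mu> (\<Union>i\<in>I. F \<inter> cball (a i) (r i))"
    proof (subst measure_UNION')
      show "pairwise (\<lambda>i j. disjnt (F \<inter> cball (a i) (r i)) (F \<inter> cball (a j) (r j))) I"
        using disj I unfolding pairwise_def disjnt_def by blast
    qed (use I F in \<open>auto simp: sum_distrib_left\<close>)
    also have "\<dots> \<le> 2 * \<theta> * 5 ^ DIM('a) * ?\<mu> F"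
      using \<theta> I F by (intro mult_left_mono measure_mono_fmeasurable sets.finite_UN) auto
    finally show "?\<mu> (\<Union>i\<in>I. E \<inter> cball (a i) (5 * r i)) \<le> 2 * \<theta> * 5 ^ DIM('a) * ?\<mu> F" .
  qed (use E in auto)
  moreover have "(\<Union>i\<in>C. E \<inter> cball (a i) (5 * r i)) = E" using cov by auto
  ultimately show ?thesis by simp
qed

text \<open>A crude form of Lebesgue density. If all small balls centred in \<open>E\<close> were
  sparse, Vitali balls inside an open set \<open>U\<close> around \<open>E\<close> with |U| < 2|E|
  would give |E| \<le> |U| / 2 < |E|.\<close>

lemma exists_dense_cball:
  fixes E :: "'a::euclidean_space set"
  assumes E: "E \<in> lmeasurable" and pos: "0 < measure lebesgue E"
    and \<theta>: "0 \<le> \<theta>" "4 * \<theta> * 5 ^ DIM('a) \<le> 1" and R: "0 < R"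
  obtains x r where "x \<in> E" "0 < r" "r < R"
    "\<theta> * measure lebesgue (cball x r) < measure lebesgue (E \<inter> cball x r)"
proof (rule ccontr)
  let ?\<mu> = "measure lebesgue :: 'a set \<Rightarrow> real"
  note main = that
  assume "\<not> thesis"
  then have H: "?\<mu> (E \<inter> cball x r) \<le> \<theta> * ?\<mu> (cball x r)" if "x \<in> E" "0 < r" "r < R" for x r
    using main[OF that] \<open>\<not> thesis\<close> not_le by blast
  obtain U where U: "open U" "E \<subseteq> U" "U - E \<in> lmeasurable" "emeasure lebesgue (U - E) < ennreal (?\<mu> E)"
    using sets_lebesgue_outer_open[OF _ pos] E by blast
  have UE: "U = E \<union> (U - E)" using U by auto
  have Um: "U \<in> lmeasurable" using E U(3) by (subst UE) (rule fmeasurable.Un)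
  have "?\<mu> (U - E) < ?\<mu> E"
    using U(3,4) by (simp add: emeasure_eq_measure2 ennreal_less_iff)
  moreover have "?\<mu> U \<le> ?\<mu> E + ?\<mu> (U - E)"
    using E U(3) by (subst UE) (rule measure_Un_le, auto)
  ultimately have U2: "?\<mu> U < 2 * ?\<mu> E" by simp
  have "\<exists>r>0. 5 * r < R \<and> cball x r \<subseteq> U" if x: "x \<in> E" for x
  proof -
    obtain e where e: "e > 0" "cball x e \<subseteq> U" using U(1,2) x open_contains_cball by blast
    \<comment> \<open>The radius keeps the ball in \<open>U\<close>, and \<open>R/6\<close> gives
      the strict inequality under which \<open>H\<close> applies to the five-fold ball.\<close>
    show ?thesis
      using e R by (intro exI[of _ "min e (R/6)"]) auto
  qed
  then obtain \<rho> where \<rho>: "\<And>x. x \<in> E \<Longrightarrow> \<rho> x > 0 \<and> 5 * \<rho> x < R \<and> cball x (\<rho> x) \<subseteq> U" by metis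
  obtain C where C: "countable C" "C \<subseteq> E"
     "pairwise (\<lambda>i j. disjnt (cball i (\<rho> i)) (cball j (\<rho> j))) C"
     "E \<subseteq> (\<Union>i\<in>C. cball i (5 * \<rho> i))"
  proof (rule Vitali_covering_lemma_cballs[of E "\<lambda>x. x" \<rho> E R])
    show "E \<subseteq> (\<Union>x\<in>E. cball x (\<rho> x))" using \<rho> by (fastforce intro: less_imp_le)
    show "0 < \<rho> i \<and> \<rho> i \<le> R" if "i \<in> E" for i using \<rho>[OF that] by linarith
  qed
  have "?\<mu> E \<le> 2 * \<theta> * 5 ^ DIM('a) * ?\<mu> U"
  proof (rule measure_le_vitali[OF E Um C(1) C(3,4)])
    fix i assume "i \<in> C"
    then have i: "i \<in> E" using C by auto
    show "0 < \<rho> i" using \<rho>[OF i] by simp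
    show "?\<mu> (E \<inter> cball i (5 * \<rho> i)) \<le> \<theta> * ?\<mu> (cball i (5 * \<rho> i))"
      using \<rho>[OF i] by (intro H[OF i]) auto
    have "U \<inter> cball i (\<rho> i) = cball i (\<rho> i)" using \<rho>[OF i] by auto
    then show "?\<mu> (cball i (\<rho> i)) \<le> 2 * ?\<mu> (U \<inter> cball i (\<rho> i))" by simp
  qed (use \<theta> in auto)
  also have "\<dots> \<le> 1/2 * ?\<mu> U" using \<theta> by (intro mult_right_mono) auto
  finally show False using U2 by simp
qed

text \<open>Otherwise every \<theta>-dense ball for \<open>E\<close> is more than half filled by
  \<open>F\<close>. Such balls cover almost all of \<open>E\<close>, and Vitali selects ones that
  cease to be dense when enlarged five times. With d the dimension, \<open>measure_le_vitali\<close>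
  gives |E| \<le> 2 \<theta> 5^d |F| \<le> 2 \<theta> 10^d |E| \<le> |E| / 2.\<close>

lemma exists_cball_meeting_both:
  fixes E F :: "'a::euclidean_space set"
  assumes E: "E \<in> lmeasurable" and F: "F \<in> lmeasurable" and pos: "0 < measure lebesgue E"
    and FE: "measure lebesgue F \<le> 2 ^ DIM('a) * measure lebesgue E"
    and \<theta>: "0 < \<theta>" "4 * \<theta> * 10 ^ DIM('a) \<le> 1"
  obtains x r where "0 < r" "\<theta> * measure lebesgue (cball x r) < measure lebesgue (E \<inter> cball x r)"
    "measure lebesgue (cball x r) \<le> 2 * measure lebesgue (cball x r - F)"
proof (rule ccontr)
  let ?\<mu> = "measure lebesgue :: 'a set \<Rightarrow> real"
  define I where "I = {(x, r). 0 < r \<and> \<theta> * ?\<mu> (cball x r) < ?\<mu> (E \<inter> cball x r)}"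
  note main = that
  assume "\<not> thesis"
  then have H: "2 * ?\<mu> (cball x r - F) < ?\<mu> (cball x r)" if "(x, r) \<in> I" for x r
    using main[of r x] that \<open>\<not> thesis\<close> unfolding I_def by fastforce
  have half: "?\<mu> (cball x r) \<le> 2 * ?\<mu> (F \<inter> cball x r)" if "(x, r) \<in> I" for x r
  proof -
    have "?\<mu> (cball x r) = ?\<mu> ((cball x r - F) \<union> (F \<inter> cball x r))" by (rule arg_cong[of _ _ ?\<mu>]) auto
    also have "\<dots> \<le> ?\<mu> (cball x r - F) + ?\<mu> (F \<inter> cball x r)"
      using F by (intro measure_Un_le) auto
    finally show ?thesis using H[OF that] by simp
  qed
  define G where "G = (\<Union>(x, r)\<in>I. ball x r)"
  have G: "open G" unfolding G_def by auto
  then have Gs: "G \<in> sets lebesgue" by simp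
  \<comment> \<open>A ball dense for \<open>E - G\<close> is dense for \<open>E\<close>, so its
    centre would lie in \<open>G\<close>.\<close>
  have null: "?\<mu> (E - G) = 0"
  proof (rule ccontr)
    assume "?\<mu> (E - G) \<noteq> 0"
    then have p: "0 < ?\<mu> (E - G)" by (simp add: zero_less_measure_iff)
    have "4 * \<theta> * 5 ^ DIM('a) \<le> 4 * \<theta> * 10 ^ DIM('a)"
      using \<theta> by (intro mult_left_mono power_mono) auto
    then have le: "4 * \<theta> * 5 ^ DIM('a) \<le> 1" using \<theta> by linarith
    have EG: "E - G \<in> lmeasurable" using E Gs by (rule fmeasurable_Diff)
    obtain x r where x: "x \<in> E - G" "0 < r" "\<theta> * ?\<mu> (cball x r) < ?\<mu> ((E - G) \<inter> cball x r)"
      using exists_dense_cball[OF EG p less_imp_le[OF \<theta>(1)] le zero_less_one] by metis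
    have "?\<mu> ((E - G) \<inter> cball x r) \<le> ?\<mu> (E \<inter> cball x r)"
      using E Gs by (intro measure_mono_fmeasurable) auto
    then have "(x, r) \<in> I" using x by (auto simp: I_def)
    then have "x \<in> G" using x unfolding G_def by force
    then show False using x by auto
  qed
  define \<omega> where "\<omega> = unit_ball_vol (DIM('a))"
  have \<omega>: "\<omega> > 0" unfolding \<omega>_def by simp
  \<comment> \<open>The volume of a dense ball is below |E| / \<theta>. This bounds the radius
    through \<open>r \<le> r ^ DIM('a)\<close> when r > 1; the \<open>max\<close> covers the other
    radii.\<close>
  define M where "M = max 1 (?\<mu> E / (\<theta> * \<omega>))"
  have rM: "r \<le> M" if "(x, r) \<in> I" for x r
  proof (cases "r \<le> 1")
    case False
    have "\<theta> * (\<omega> * r ^ DIM('a)) < ?\<mu> (E \<inter> cball x r)"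
      using that False unfolding I_def by (simp add: content_cball \<omega>_def)
    also have "\<dots> \<le> ?\<mu> E" using E by (intro measure_mono_fmeasurable) auto
    finally have "r ^ DIM('a) < ?\<mu> E / (\<theta> * \<omega>)" using \<theta> \<omega> by (simp add: field_simps)
    moreover have "r \<le> r ^ DIM('a)" using False DIM_positive[where 'a='a] by (intro self_le_power) auto
    ultimately show ?thesis unfolding M_def by linarith
  qed (auto simp: M_def)
  \<comment> \<open>Maximality is tested only against the factor 5, the enlargement of the Vitali
    lemma, so its covering balls are sparse. Every dense ball lies in such a ball, because repeated
    enlargement eventually exceeds the radius bound \<open>M\<close>.\<close>
  define K where "K = {(x, r). (x, r) \<in> I \<and> (x, 5 * r) \<notin> I}"
  have IK: "\<exists>s\<ge>r. (x, s) \<in> K" if I: "(x, r) \<in> I" for x r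
  proof -
    have r0: "0 < r" using I by (auto simp: I_def)
    have "\<exists>k. (x, 5 ^ k * r) \<notin> I"
    proof -
      obtain k where "M / r < 5 ^ k" using real_arch_pow[of 5 "M / r"] by auto
      then have "M < 5 ^ k * r" using r0 by (simp add: field_simps)
      then show ?thesis using rM by (meson not_le)
    qed
    then obtain k where k: "(x, 5 ^ k * r) \<notin> I" "\<forall>j<k. (x, 5 ^ j * r) \<in> I"
      using exists_least_iff[of "\<lambda>k. (x, 5 ^ k * r) \<notin> I"] by blast
    then obtain j where j: "k = Suc j" using I by (cases k) auto
    have "(x, 5 ^ j * r) \<in> K" using k j by (auto simp: K_def mult_ac)
    moreover have "r \<le> 5 ^ j * r" using r0 by simp
    ultimately show ?thesis by blast
  qed
  have GK: "G \<subseteq> (\<Union>i\<in>K. cball (fst i) (snd i))"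
  proof
    fix y assume "y \<in> G"
    then obtain x r where xr: "(x, r) \<in> I" "y \<in> ball x r" unfolding G_def by auto
    then obtain s where "s \<ge> r" "(x, s) \<in> K" using IK by blast
    then show "y \<in> (\<Union>i\<in>K. cball (fst i) (snd i))" using xr by (intro UN_I[of "(x, s)"]) auto
  qed
  obtain C where C: "countable C" "C \<subseteq> K"
     "pairwise (\<lambda>i j. disjnt (cball (fst i) (snd i)) (cball (fst j) (snd j))) C"
     "G \<subseteq> (\<Union>i\<in>C. cball (fst i) (5 * snd i))"
  proof (rule Vitali_covering_lemma_cballs[OF GK])
    show "0 < snd i \<and> snd i \<le> M" if "i \<in> K" for i
      using that rM by (auto simp: K_def I_def)
  qed blast
  have EG: "E \<inter> G \<in> lmeasurable" using E Gs by (rule fmeasurable_Int_fmeasurable)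
  have "?\<mu> E = ?\<mu> ((E \<inter> G) \<union> (E - G))" by (rule arg_cong[of _ _ ?\<mu>]) auto
  also have "\<dots> \<le> ?\<mu> (E \<inter> G) + ?\<mu> (E - G)" using E Gs by (intro measure_Un_le) auto
  also have "\<dots> = ?\<mu> (E \<inter> G)" using null by simp
  also have "\<dots> \<le> 2 * \<theta> * 5 ^ DIM('a) * ?\<mu> F"
  proof (rule measure_le_vitali[OF EG F C(1) C(3)])
    show "E \<inter> G \<subseteq> (\<Union>i\<in>C. cball (fst i) (5 * snd i))" using C(4) by auto
    fix i assume "i \<in> C"
    then have i: "(fst i, snd i) \<in> I" "(fst i, 5 * snd i) \<notin> I" using C(2) by (auto simp: K_def)
    show "0 < snd i" using i(1) by (auto simp: I_def)
    show "?\<mu> (cball (fst i) (snd i)) \<le> 2 * ?\<mu> (F \<inter> cball (fst i) (snd i))" by (rule half[OF i(1)])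
    have "?\<mu> (E \<inter> G \<inter> cball (fst i) (5 * snd i)) \<le> ?\<mu> (E \<inter> cball (fst i) (5 * snd i))"
      using E Gs by (intro measure_mono_fmeasurable) auto
    also have "\<dots> \<le> \<theta> * ?\<mu> (cball (fst i) (5 * snd i))"
      using i \<open>0 < snd i\<close> by (auto simp: I_def not_less)
    finally show "?\<mu> (E \<inter> G \<inter> cball (fst i) (5 * snd i)) \<le> \<theta> * ?\<mu> (cball (fst i) (5 * snd i))" .
  qed (use \<theta> in auto)
  also have "\<dots> \<le> 2 * \<theta> * 5 ^ DIM('a) * (2 ^ DIM('a) * ?\<mu> E)"
    using \<theta> FE by (intro mult_left_mono) auto
  also have "\<dots> = (2 * \<theta> * 10 ^ DIM('a)) * ?\<mu> E"
    using power_mult_distrib[of 5 "2::real" "DIM('a)"] by simp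
  also have "\<dots> \<le> 1/2 * ?\<mu> E" using \<theta> by (intro mult_right_mono) auto
  finally show False using pos by simp
qed

text \<open>Translate a dense ball along a line in steps of its radius. Since \<open>E\<close> has
  finite measure, density fails at some step, and the first failure is next to a dense ball of the
  same radius.\<close>

lemma exists_adjacent_cballs:
  fixes E :: "'a::euclidean_space set"
  assumes E: "E \<in> lmeasurable" and pos: "0 < measure lebesgue E"
    and \<theta>: "0 < \<theta>" "4 * \<theta> * 5 ^ DIM('a) \<le> 1" and R: "0 < R"
  obtains y z r where "0 < r" "r < R" "dist y z = r"
    "\<theta> * measure lebesgue (cball y r) < measure lebesgue (E \<inter> cball y r)"
    "measure lebesgue (E \<inter> cball z r) \<le> \<theta> * measure lebesgue (cball z r)"
proof -
  let ?\<mu> = "measure lebesgue :: 'a set \<Rightarrow> real"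
  obtain x r where x: "0 < r" "r < R" "\<theta> * ?\<mu> (cball x r) < ?\<mu> (E \<inter> cball x r)"
    using exists_dense_cball[OF E pos less_imp_le[OF \<theta>(1)] \<theta>(2) R] by metis
  obtain e :: 'a where e: "norm e = 1" using vector_choose_size[of 1] by auto
  define p where "p k = x + (real k * r) *\<^sub>R e" for k
  define P where "P k \<longleftrightarrow> \<theta> * ?\<mu> (cball (p k) r) < ?\<mu> (E \<inter> cball (p k) r)" for k
  define v where "v = unit_ball_vol (DIM('a)) * r ^ DIM('a)"
  have v: "0 < v" unfolding v_def using x by simp
  have bv: "?\<mu> (cball y r) = v" for y :: 'a using x by (simp add: content_cball v_def)
  have dist: "dist (p j) (p k) = \<bar>real j - real k\<bar> * r" for j k
  proof -
    have "p j - p k = ((real j - real k) * r) *\<^sub>R e" unfolding p_def by (simp add: algebra_simps)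
    then show ?thesis using e x by (simp add: dist_norm abs_mult)
  qed
  \<comment> \<open>Every third ball is taken, which makes them disjoint; \<open>N\<close> dense
    ones would carry at least \<open>N * (\<theta> * v)\<close>, more than |E| for large
    \<open>N\<close>.\<close>
  have "\<exists>k. \<not> P k"
  proof (rule ccontr)
    assume "\<not> (\<exists>k. \<not> P k)"
    then have P: "\<theta> * v < ?\<mu> (E \<inter> cball (p k) r)" for k by (auto simp: P_def bv)
    obtain N :: nat where "?\<mu> E / (\<theta> * v) < real N" using reals_Archimedean2 by blast
    then have N: "?\<mu> E < real N * (\<theta> * v)" using \<theta> v by (simp add: field_simps)
    have "real N * (\<theta> * v) = (\<Sum>k<N. \<theta> * v)" by simp
    also have "\<dots> \<le> (\<Sum>k<N. ?\<mu> (E \<inter> cball (p (3 * k)) r))"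
      using P by (intro sum_mono less_imp_le)
    also have "\<dots> = ?\<mu> (\<Union>k<N. E \<inter> cball (p (3 * k)) r)"
    proof (rule measure_UNION'[symmetric])
      show "pairwise (\<lambda>i j. disjnt (E \<inter> cball (p (3 * i)) r) (E \<inter> cball (p (3 * j)) r)) {..<N}"
      proof (rule pairwiseI)
        fix i j :: nat assume "i \<noteq> j"
        then have "3 \<le> \<bar>real (3 * i) - real (3 * j)\<bar>" by linarith
        then have "3 * r \<le> dist (p (3 * i)) (p (3 * j))"
          using x by (subst dist) (intro mult_right_mono, auto)
        then have "False" if "w \<in> cball (p (3 * i)) r" "w \<in> cball (p (3 * j)) r" for w
          using that dist_triangle2[of "p (3 * i)" "p (3 * j)" w] x by auto
        then show "disjnt (E \<inter> cball (p (3 * i)) r) (E \<inter> cball (p (3 * j)) r)"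
          unfolding disjnt_def by blast
      qed
    qed (use E in auto)
    also have "\<dots> \<le> ?\<mu> E" using E by (intro measure_mono_fmeasurable) auto
    finally show False using N by simp
  qed
  then obtain k where k: "\<not> P k" "\<forall>j<k. P j"
    using exists_least_iff[of "\<lambda>k. \<not> P k"] by blast
  have "P 0" using x by (simp add: P_def p_def)
  then obtain j where j: "k = Suc j" using k by (cases k) auto
  show thesis
  proof (rule that[OF x(1,2)])
    show "dist (p j) (p k) = r" using x by (simp add: dist j)
    show "\<theta> * ?\<mu> (cball (p j) r) < ?\<mu> (E \<inter> cball (p j) r)" using k j by (simp add: P_def)
    show "?\<mu> (E \<inter> cball (p k) r) \<le> \<theta> * ?\<mu> (cball (p k) r)" using k by (simp add: P_def)
  qed
qed

subsection \<open>Mean oscillation on cubes\<close>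

lemma measure_cube:
  fixes a :: "real^'n"
  assumes "0 < l"
  shows "measure lebesgue (box a (a + (\<chi> i. l))) = l ^ CARD('n)"
proof -
  have "measure lebesgue (box a (a + (\<chi> i. l))) = measure lborel (cbox a (a + (\<chi> i. l)))"
    by (simp add: measure_lborel_box_eq measure_lborel_cbox_eq)
  also have "\<dots> = (\<Prod>i\<in>(UNIV::'n set). (a + (\<chi> i. l)) $ i - a $ i)"
    using assms by (intro content_cbox_cart) (auto simp: interval_ne_empty_cart less_imp_le)
  finally show ?thesis by simp
qed

lemma is_cubeE:
  fixes Q :: "(real^'n) set"
  assumes "is_cube Q"
  obtains a l where "0 < l" "Q = box a (a + (\<chi> i. l))" "measure lebesgue Q = l ^ CARD('n)"
    "Q \<in> lmeasurable" "0 < measure lebesgue Q"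
proof -
  obtain a l where *: "0 < l" "Q = box a (a + (\<chi> i. l))" using assms unfolding is_cube_def by blast
  show thesis
    by (rule that[OF *]) (use * measure_cube[OF *(1), of a] in auto)
qed

lemma mean_osc_nonneg: "0 \<le> mean_osc f Q"
  unfolding mean_osc_def set_lebesgue_integral_def by (intro divide_nonneg_nonneg integral_nonneg) auto

lemma set_integrable_const_fmeasurable:
  fixes k :: real
  assumes "A \<in> fmeasurable M"
  shows "set_integrable M A (\<lambda>x. k)"
proof -
  have "integrable M (indicator A :: _ \<Rightarrow> real)"
    using assms by (intro integrable_real_indicator) (auto simp: fmeasurable_def)
  then show ?thesis unfolding set_integrable_def by simp
qed

text \<open>Any constant \<open>c\<close> may replace the average at the cost of a factor 2, because
  |f_Q - c| is at most the average of |f - c|.\<close>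

lemma mean_osc_le:
  fixes f :: "real^'n \<Rightarrow> real"
  assumes Q: "is_cube Q" and f: "set_integrable lebesgue Q f"
    and c: "(LINT x:Q|lebesgue. \<bar>f x - c\<bar>) \<le> b * measure lebesgue Q"
  shows "mean_osc f Q \<le> 2 * b"
proof -
  let ?\<mu> = "measure lebesgue Q"
  have Q': "Q \<in> lmeasurable" "0 < ?\<mu>" using is_cubeE[OF Q] by metis+
  have const: "set_integrable lebesgue Q (\<lambda>x. k :: real)" for k
    using Q'(1) by (rule set_integrable_const_fmeasurable)
  have ci: "(LINT x:Q|lebesgue. k) = k * ?\<mu>" for k :: real
    using Q' unfolding set_lebesgue_integral_def by simp
  let ?A = "cube_avg f Q"
  have fc: "set_integrable lebesgue Q (\<lambda>x. f x - k)" for k using f const by (rule set_integral_diff)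
  have "?A - c = (LINT x:Q|lebesgue. f x - c) / ?\<mu>"
    using Q' f const by (simp add: cube_avg_def set_integral_diff ci field_simps)
  also have "\<bar>\<dots>\<bar> \<le> (LINT x:Q|lebesgue. \<bar>f x - c\<bar>) / ?\<mu>"
    using set_integral_norm_bound[OF fc[of c]] Q' by (simp add: divide_right_mono)
  also have "\<dots> \<le> b" using c Q' by (simp add: divide_le_eq)
  finally have A: "\<bar>?A - c\<bar> \<le> b" .
  have "(LINT x:Q|lebesgue. \<bar>f x - ?A\<bar>) \<le> (LINT x:Q|lebesgue. \<bar>f x - c\<bar> + b)"
    using A fc const by (intro set_integral_mono set_integrable_abs set_integral_add) auto
  also have "\<dots> = (LINT x:Q|lebesgue. \<bar>f x - c\<bar>) + b * ?\<mu>"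
    using fc const by (subst set_integral_add) (auto intro: set_integrable_abs simp: ci)
  also have "\<dots> \<le> 2 * b * ?\<mu>" using c by simp
  finally show ?thesis using Q' by (simp add: mean_osc_def divide_le_eq)
qed

text \<open>The average cannot be close to both levels: if |f_Q| is at most their midpoint,
  \<open>f\<close> stays (\<beta> - \<alpha>)/2 away from f_Q on \<open>E\<close>, and otherwise off
  \<open>F\<close>. The reverse triangle inequality passes from |f| to \<open>f\<close>.\<close>

lemma mean_osc_ge:
  fixes f :: "real^'n \<Rightarrow> real"
  assumes Q: "is_cube Q" and f: "set_integrable lebesgue Q f"
    and E: "E \<in> sets lebesgue" "m \<le> measure lebesgue (Q \<inter> E)" "\<And>x. x \<in> E \<Longrightarrow> \<beta> \<le> \<bar>f x\<bar>"
    and F: "F \<in> sets lebesgue" "m \<le> measure lebesgue (Q - F)" "\<And>x. x \<notin> F \<Longrightarrow> \<bar>f x\<bar> \<le> \<alpha>"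
    and le: "\<alpha> \<le> \<beta>"
  shows "(\<beta> - \<alpha>) * m \<le> 2 * measure lebesgue Q * mean_osc f Q"
proof -
  let ?\<mu> = "measure lebesgue Q"
  have Q': "Q \<in> lmeasurable" "0 < ?\<mu>" using is_cubeE[OF Q] by metis+
  have const: "set_integrable lebesgue Q (\<lambda>x. k :: real)" for k
    using Q'(1) by (rule set_integrable_const_fmeasurable)
  let ?A = "cube_avg f Q"
  have fc: "set_integrable lebesgue Q (\<lambda>x. \<bar>f x - ?A\<bar>)"
    by (intro set_integrable_abs set_integral_diff f const)
  have key: "(\<beta> - \<alpha>) * m \<le> 2 * (LINT x:Q|lebesgue. \<bar>f x - ?A\<bar>)"
    if T: "T \<in> sets lebesgue" "T \<subseteq> Q" "m \<le> measure lebesgue T"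
      and TA: "\<And>x. x \<in> T \<Longrightarrow> (\<beta> - \<alpha>) / 2 \<le> \<bar>f x - ?A\<bar>" for T
  proof -
    have Tm: "T \<in> lmeasurable" using fmeasurableI2[OF Q'(1) T(2,1)] .
    have "(\<beta> - \<alpha>) / 2 * m \<le> (\<beta> - \<alpha>) / 2 * measure lebesgue T"
      using le T by (intro mult_left_mono) auto
    also have "\<dots> = (LINT x:T|lebesgue. (\<beta> - \<alpha>) / 2)"
      using Tm unfolding set_lebesgue_integral_def by simp
    also have "\<dots> = (LINT x:Q|lebesgue. indicator T x * ((\<beta> - \<alpha>) / 2))"
      unfolding set_lebesgue_integral_def using T by (intro Bochner_Integration.integral_cong) (auto simp: indicator_def)
    also have "\<dots> \<le> (LINT x:Q|lebesgue. \<bar>f x - ?A\<bar>)"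
    proof (rule set_integral_mono[OF _ fc])
      have "set_integrable lebesgue T (\<lambda>x. (\<beta> - \<alpha>) / 2)"
        using Tm by (rule set_integrable_const_fmeasurable)
      then show "set_integrable lebesgue Q (\<lambda>x. indicator T x * ((\<beta> - \<alpha>) / 2))"
        unfolding set_integrable_def
        by (rule Bochner_Integration.integrable_cong[THEN iffD1, rotated 2]) (use T in \<open>auto simp: indicator_def\<close>)
      show "indicator T x * ((\<beta> - \<alpha>) / 2) \<le> \<bar>f x - ?A\<bar>" for x
        using TA[of x] by (auto simp: indicator_def)
    qed
    finally show ?thesis by (simp add: field_simps)
  qed
  have "(\<beta> - \<alpha>) * m \<le> 2 * (LINT x:Q|lebesgue. \<bar>f x - ?A\<bar>)"
  proof (cases "\<bar>?A\<bar> \<le> (\<alpha> + \<beta>) / 2")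
    case True
    have "(\<beta> - \<alpha>) / 2 \<le> \<bar>f x - ?A\<bar>" if "x \<in> Q \<inter> E" for x
    proof -
      have "\<beta> \<le> \<bar>f x\<bar>" using that E(3) by auto
      then show ?thesis using True by (simp add: abs_if field_simps split: if_splits)
    qed
    then show ?thesis using E Q' by (intro key[of "Q \<inter> E"]) auto
  next
    case False
    have "(\<beta> - \<alpha>) / 2 \<le> \<bar>f x - ?A\<bar>" if "x \<in> Q - F" for x
    proof -
      have "\<bar>f x\<bar> \<le> \<alpha>" using that F(3) by auto
      then show ?thesis using False by (simp add: abs_if field_simps split: if_splits)
    qed
    then show ?thesis using F Q' by (intro key[of "Q - F"]) auto
  qed
  then show ?thesis using Q' by (simp add: mean_osc_def)
qed

text \<open>Removes the extended-real suprema: finiteness becomes a real bound, and the limit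
  becomes an epsilon-delta condition because the supremum is monotone in \<delta>.\<close>

lemma VMO_iff:
  fixes f :: "real^'n \<Rightarrow> real"
  shows "f \<in> VMO \<longleftrightarrow> (\<forall>Q. is_cube Q \<longrightarrow> set_integrable lebesgue Q f) \<and>
    (\<exists>B. \<forall>Q. is_cube Q \<longrightarrow> mean_osc f Q \<le> B) \<and>
    (\<forall>\<epsilon>>0. \<exists>\<delta>>0. \<forall>Q. is_cube Q \<and> measure lebesgue Q \<le> \<delta> \<longrightarrow> mean_osc f Q \<le> \<epsilon>)"
    (is "_ \<longleftrightarrow> ?I \<and> ?B \<and> ?V")
proof -
  define s where "s \<delta> = (SUP Q\<in>{Q :: (real^'n) set. is_cube Q \<and> measure lebesgue Q \<le> \<delta>}. ereal (mean_osc f Q))"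
    for \<delta> :: real
  have B: "(SUP Q\<in>{Q :: (real^'n) set. is_cube Q}. ereal (mean_osc f Q)) < \<infinity> \<longleftrightarrow> ?B" (is "?S < \<infinity> \<longleftrightarrow> _")
  proof
    assume "?S < \<infinity>"
    then obtain B where "?S < ereal B" using ereal_dense2 by blast
    moreover have "ereal (mean_osc f Q) \<le> ?S" if "is_cube Q" for Q using that by (intro SUP_upper) simp
    ultimately have "mean_osc f Q \<le> B" if "is_cube Q" for Q
      using that by (meson ereal_less_eq(3) less_imp_le order_trans)
    then show ?B by blast
  next
    assume ?B
    then obtain B where "\<And>Q. is_cube Q \<Longrightarrow> mean_osc f Q \<le> B" by blast
    then have "?S \<le> ereal B" by (intro SUP_least) auto
    also have "ereal B < \<infinity>" by simp
    finally show "?S < \<infinity>" .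
  qed
  have mono: "s \<delta> \<le> s \<delta>'" if "\<delta> \<le> \<delta>'" for \<delta> \<delta>'
    unfolding s_def using that by (intro SUP_subset_mono) auto
  \<comment> \<open>A supremum over no cubes would be minus infinity, so a cube of volume at most
    \<delta> is exhibited. A side at most 1 makes the volume at most the side.\<close>
  have s0: "0 \<le> s \<delta>" if "0 < \<delta>" for \<delta>
  proof -
    define l where "l = min 1 \<delta>"
    have l: "0 < l" "l \<le> 1" "l \<le> \<delta>" using that by (auto simp: l_def)
    let ?Q = "box (0 :: real^'n) (0 + (\<chi> i. l))"
    have "l ^ CARD('n) \<le> l ^ 1" using l by (intro power_decreasing) (auto simp: Suc_leI)
    then have "is_cube ?Q \<and> measure lebesgue ?Q \<le> \<delta>"
      using l measure_cube[OF l(1), of "0 :: real^'n"] unfolding is_cube_def by fastforce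
    then have "ereal (mean_osc f ?Q) \<le> s \<delta>" unfolding s_def by (intro SUP_upper) auto
    moreover have "0 \<le> ereal (mean_osc f ?Q)" using mean_osc_nonneg by simp
    ultimately show ?thesis by (rule order_trans[rotated])
  qed
  have V: "(s \<longlongrightarrow> 0) (at_right 0) \<longleftrightarrow> ?V"
  proof
    assume lim: "(s \<longlongrightarrow> 0) (at_right 0)"
    show ?V
    proof (intro allI impI)
      fix \<epsilon> :: real assume "0 < \<epsilon>"
      then have "\<forall>\<^sub>F \<delta> in at_right 0. s \<delta> < ereal \<epsilon>" using order_tendstoD(2)[OF lim, of "ereal \<epsilon>"] by simp
      then obtain b where b: "b > 0" "\<And>\<delta>. 0 < \<delta> \<Longrightarrow> \<delta> < b \<Longrightarrow> s \<delta> < ereal \<epsilon>"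
        unfolding eventually_at_right_field by auto
      have "s (b/2) < ereal \<epsilon>" using b by simp
      then have "mean_osc f Q \<le> \<epsilon>" if "is_cube Q" "measure lebesgue Q \<le> b/2" for Q
      proof -
        have "ereal (mean_osc f Q) \<le> s (b/2)" unfolding s_def using that by (intro SUP_upper) simp
        also note \<open>s (b/2) < ereal \<epsilon>\<close>
        finally show ?thesis by simp
      qed
      then show "\<exists>\<delta>>0. \<forall>Q. is_cube Q \<and> measure lebesgue Q \<le> \<delta> \<longrightarrow> mean_osc f Q \<le> \<epsilon>"
        using b by (intro exI[of _ "b/2"]) auto
    qed
  next
    assume V: ?V
    show "(s \<longlongrightarrow> 0) (at_right 0)"
    proof (rule order_tendstoI)
      fix y :: ereal assume "y < 0"
      then show "\<forall>\<^sub>F \<delta> in at_right 0. y < s \<delta>"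
        using s0 unfolding eventually_at_right_field by (intro exI[of _ 1]) (auto intro: less_le_trans)
    next
      fix y :: ereal assume "0 < y"
      then obtain \<epsilon> where \<epsilon>: "0 < ereal \<epsilon>" "ereal \<epsilon> < y" using ereal_dense2 by blast
      then obtain \<delta> where \<delta>: "\<delta> > 0" "\<And>Q. is_cube Q \<and> measure lebesgue Q \<le> \<delta> \<Longrightarrow> mean_osc f Q \<le> \<epsilon>"
        using V by auto
      then have "s \<delta> \<le> ereal \<epsilon>" unfolding s_def by (intro SUP_least) auto
      then have "s \<delta>' < y" if "\<delta>' < \<delta>" for \<delta>' using mono[of \<delta>' \<delta>] that \<epsilon>(2) by (meson less_imp_le le_less_trans)
      then show "\<forall>\<^sub>F \<delta> in at_right 0. s \<delta> < y"
        using \<delta>(1) unfolding eventually_at_right_field by blast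
    qed
  qed
  show ?thesis
    using B V unfolding VMO_def BMO_def s_def by auto
qed

subsection \<open>Radially decreasing functions of vanishing mean oscillation\<close>

text \<open>Telescoping; \<open>2 ^ m * r < 2 * R\<close> places every point that gets doubled below
  \<open>R\<close>.\<close>

lemma doubling_iterate:
  fixes \<phi> :: "real \<Rightarrow> real"
  assumes "\<And>x. 0 < x \<Longrightarrow> x < R \<Longrightarrow> \<phi> x - \<phi> (2 * x) \<le> D" and "0 < r"
  shows "2 ^ m * r < 2 * R \<Longrightarrow> \<phi> r - \<phi> (2 ^ m * r) \<le> real m * D"
proof (induction m)
  case (Suc m)
  then have "2 ^ m * r < R" by simp
  moreover have "0 < 2 ^ m * r" using assms(2) by simp
  ultimately have "2 ^ m * r < R" "2 ^ m * r < 2 * R" by linarith+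
  then show ?case
    using Suc.IH assms(1)[of "2 ^ m * r"] assms(2) by (simp add: algebra_simps)
qed simp

text \<open>Beyond some \<open>b\<close> the function is within \<open>e\<close> of its infimum on
  \<open>{a..}\<close> and cannot drop by \<open>e\<close> any more; before \<open>b\<close>,
  compactness applies.\<close>

lemma antimono_on_uniformly_continuous:
  fixes \<phi> :: "real \<Rightarrow> real"
  assumes anti: "antimono_on {0<..} \<phi>" and nonneg: "\<And>x. 0 < x \<Longrightarrow> 0 \<le> \<phi> x"
    and cont: "continuous_on {0<..} \<phi>" and a: "0 < a" and e: "0 < e"
  obtains \<delta> where "0 < \<delta>" "\<And>x y. a \<le> x \<Longrightarrow> x \<le> y \<Longrightarrow> y \<le> x + \<delta> \<Longrightarrow> \<phi> x - \<phi> y \<le> e"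
proof -
  define L where "L = Inf (\<phi> ` {a..})"
  have bdd: "bdd_below (\<phi> ` {a..})" using nonneg a by (intro bdd_belowI[of _ 0]) force
  obtain b where b: "a \<le> b" "\<phi> b < L + e"
    using cInf_lessD[of "\<phi> ` {a..}" "L + e"] e unfolding L_def by auto
  have L: "L \<le> \<phi> y" if "a \<le> y" for y
    unfolding L_def using that bdd by (intro cInf_lower) auto
  \<comment> \<open>The interval extends past \<open>b\<close> by 1, so that it contains
    \<open>y\<close> whenever x \<le> b and y - x \<le> 1.\<close>
  have "uniformly_continuous_on {a..b+1} \<phi>"
    using a by (intro compact_uniformly_continuous continuous_on_subset[OF cont]) auto
  then obtain d where d: "d > 0" "\<And>x y. x \<in> {a..b+1} \<Longrightarrow> y \<in> {a..b+1} \<Longrightarrow> dist y x < d \<Longrightarrow> dist (\<phi> y) (\<phi> x) < e"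
    using e unfolding uniformly_continuous_on_def by metis
  show thesis
  proof (rule that[of "min 1 (d/2)"])
    fix x y assume xy: "a \<le> x" "x \<le> y" "y \<le> x + min 1 (d/2)"
    show "\<phi> x - \<phi> y \<le> e"
    proof (cases "x \<le> b")
      case True
      have "dist (\<phi> y) (\<phi> x) < e" using True d xy by (intro d(2)) (auto simp: dist_real_def)
      then show ?thesis by (simp add: dist_real_def)
    next
      case False
      then have "\<phi> x \<le> \<phi> b" using a b by (intro monotone_onD[OF anti]) auto
      then show ?thesis using b L[of y] xy by linarith
    qed
  qed (use d in auto)
qed

section \<open>Radial functions and their integrals over balls about the origin\<close>

definition radial :: "(real \<Rightarrow> real) \<Rightarrow> 'a::real_normed_vector \<Rightarrow> real" where
  "radial \<phi> x = (if x = 0 then 0 else \<phi> (norm x))"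

lemma radial_measurable:
  fixes \<phi> :: "real \<Rightarrow> real"
  assumes cont: "continuous_on {0<..} \<phi>"
  shows "(radial \<phi> :: 'a::euclidean_space \<Rightarrow> real) \<in> borel_measurable lebesgue"
proof -
  have c: "continuous_on (- {0 :: 'a}) (\<lambda>x. \<phi> (norm x))"
    by (rule continuous_on_compose2[OF cont]) (auto intro: continuous_intros)
  have "(\<lambda>x. indicator (- {0 :: 'a}) x *\<^sub>R \<phi> (norm x)) \<in> borel_measurable borel"
    by (rule borel_measurable_continuous_on_indicator[OF _ c]) auto
  also have "(\<lambda>x. indicator (- {0 :: 'a}) x *\<^sub>R \<phi> (norm x)) = radial \<phi>"
    by (auto simp: radial_def indicator_def)
  finally show ?thesis by (intro measurable_completion) simp
qed

text \<open>At almost every x the excess over \<open>\<phi> R\<close> is at most \<open>D\<close>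
  times the number of balls of radius \<open>R / 2 ^ k\<close> containing x, and the volumes of
  these balls sum to at most twice that of the first. The nonnegative integral is used so that
  integrability follows as well.\<close>

lemma radial_nn_integral_ball:
  fixes \<phi> :: "real \<Rightarrow> real"
  assumes anti: "antimono_on {0<..} \<phi>" and cont: "continuous_on {0<..} \<phi>"
    and D: "\<And>x. 0 < x \<Longrightarrow> x < R \<Longrightarrow> \<phi> x - \<phi> (2 * x) \<le> D" and R: "0 < R"
  shows "(\<integral>\<^sup>+x. ennreal \<bar>indicator (ball (0 :: 'a::euclidean_space) R) x *\<^sub>R (radial \<phi> x - \<phi> R)\<bar> \<partial>lebesgue)
    \<le> ennreal (2 * D * measure lebesgue (ball (0 :: 'a) R))"
proof -
  have D0: "0 \<le> D"
    using D[of "R/2"] R monotone_onD[OF anti, of "R/2" R] by simp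
  let ?B = "\<lambda>k::nat. ball (0 :: 'a) (R / 2 ^ k)"
  have "(\<integral>\<^sup>+x. ennreal \<bar>indicator (ball (0 :: 'a) R) x *\<^sub>R (radial \<phi> x - \<phi> R)\<bar> \<partial>lebesgue)
    \<le> (\<integral>\<^sup>+x. (\<Sum>k. ennreal D * indicator (?B k) x) \<partial>lebesgue)"
  proof (rule nn_integral_mono_AE)
    have "{0 :: 'a} \<in> null_sets lebesgue" by simp
    then have "AE x::'a in lebesgue. x \<noteq> 0" using AE_not_in by fastforce
    then show "AE x::'a in lebesgue. ennreal \<bar>indicator (ball 0 R) x *\<^sub>R (radial \<phi> x - \<phi> R)\<bar>
        \<le> (\<Sum>k. ennreal D * indicator (?B k) x)"
    proof eventually_elim
      fix x :: 'a assume x0: "x \<noteq> 0"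
      show "ennreal \<bar>indicator (ball 0 R) x *\<^sub>R (radial \<phi> x - \<phi> R)\<bar> \<le> (\<Sum>k. ennreal D * indicator (?B k) x)"
      proof (cases "norm x < R")
        case True
        define r where "r = norm x"
        have r: "0 < r" "r < R" using True x0 by (auto simp: r_def)
        obtain k where "R / r < 2 ^ k" using real_arch_pow[of 2 "R / r"] by auto
        then have "\<exists>k. R \<le> 2 ^ k * r" using r by (auto simp: field_simps intro: less_imp_le)
        \<comment> \<open>\<open>p\<close> counts the doublings that take \<open>r\<close> to
          \<open>R\<close> or beyond. Minimality gives both r < R / 2^j for j < p and
          \<open>2 ^ p * r < 2 * R\<close>.\<close>
        then obtain p where p1: "R \<le> 2 ^ p * r" and "\<forall>j<p. \<not> R \<le> 2 ^ j * r"
          using exists_least_iff[of "\<lambda>k. R \<le> 2 ^ k * r"] by blast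
        then have p2: "2 ^ j * r < R" if "j < p" for j using that by auto
        have p0: "p \<noteq> 0" using p1 r by (cases p) auto
        then have "2 ^ p * r < 2 * R" using p2[of "p - 1"] by (cases p) auto
        then have "\<phi> r - \<phi> (2 ^ p * r) \<le> real p * D"
          by (intro doubling_iterate[of R \<phi> D r]) (use D r in auto)
        moreover have "\<phi> (2 ^ p * r) \<le> \<phi> R" using p1 R by (intro monotone_onD[OF anti]) auto
        moreover have "\<phi> R \<le> \<phi> r" using r by (intro monotone_onD[OF anti]) auto
        ultimately have "\<bar>\<phi> r - \<phi> R\<bar> \<le> real p * D" by simp
        then have "ennreal \<bar>\<phi> r - \<phi> R\<bar> \<le> ennreal (real p * D)" by (rule ennreal_leI)
        also have "\<dots> = (\<Sum>k<p. ennreal D * indicator (?B k) x)"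
        proof -
          have "norm x < R / 2 ^ k" if "k < p" for k
            using p2[OF that] by (simp add: r_def field_simps)
          then have "(\<Sum>k<p. ennreal D * indicator (?B k) x) = (\<Sum>k<p. ennreal D)"
            by (intro sum.cong) auto
          then show ?thesis using D0 by (simp add: ennreal_mult ennreal_of_nat_eq_real_of_nat)
        qed
        also have "\<dots> \<le> (\<Sum>k. ennreal D * indicator (?B k) x)"
          by (intro sum_le_suminf) auto
        finally show ?thesis using x0 True by (simp add: radial_def r_def)
      qed simp
    qed
  qed
  also have "\<dots> = (\<Sum>k. \<integral>\<^sup>+x. ennreal D * indicator (?B k) x \<partial>lebesgue)"
    by (intro nn_integral_suminf borel_measurable_times_ennreal borel_measurable_indicator) auto
  also have "\<dots> = (\<Sum>k. ennreal D * emeasure lebesgue (?B k))"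
    by (simp add: nn_integral_cmult_indicator)
  also have "\<dots> \<le> (\<Sum>k. ennreal (D * measure lebesgue (ball (0 :: 'a) R) * (1/2) ^ k))"
  proof (rule suminf_le)
    fix k
    \<comment> \<open>In every dimension the volumes shrink at least like 2^-k, whose series sums to
      2.\<close>
    have "(1 / 2 ^ k) ^ DIM('a) \<le> (1 / 2 ^ k :: real) ^ 1"
      using DIM_positive[where 'a='a] by (intro power_decreasing) (auto simp: Suc_leI)
    then have "unit_ball_vol (DIM('a)) * (R ^ DIM('a) * (1 / 2 ^ k) ^ DIM('a))
        \<le> unit_ball_vol (DIM('a)) * (R ^ DIM('a) * (1 / 2 ^ k))"
      using R by (intro mult_left_mono) auto
    then have "measure lebesgue (?B k) \<le> measure lebesgue (ball (0 :: 'a) R) * (1/2) ^ k"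
      using R by (simp add: content_ball power_divide mult_ac)
    then have "D * measure lebesgue (?B k) \<le> D * (measure lebesgue (ball (0 :: 'a) R) * (1/2) ^ k)"
      using D0 by (rule mult_left_mono)
    moreover have "ennreal D * emeasure lebesgue (?B k) = ennreal (D * measure lebesgue (?B k))"
      using D0 by (subst emeasure_eq_measure2) (auto simp: ennreal_mult)
    ultimately show "ennreal D * emeasure lebesgue (?B k)
        \<le> ennreal (D * measure lebesgue (ball (0 :: 'a) R) * (1/2) ^ k)"
      by (auto simp: mult.assoc intro: ennreal_leI)
  qed auto
  also have "\<dots> = ennreal (\<Sum>k. D * measure lebesgue (ball (0 :: 'a) R) * (1/2) ^ k)"
    using D0 by (intro suminf_ennreal2) (auto intro!: summable_mult)
  also have "(\<Sum>k. D * measure lebesgue (ball (0 :: 'a) R) * (1/2) ^ k) = 2 * D * measure lebesgue (ball (0 :: 'a) R)"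
    by (subst suminf_mult) (auto simp: suminf_geometric)
  finally show ?thesis .
qed

lemma radial_integral_ball:
  fixes \<phi> :: "real \<Rightarrow> real"
  assumes anti: "antimono_on {0<..} \<phi>" and cont: "continuous_on {0<..} \<phi>"
    and D: "\<And>x. 0 < x \<Longrightarrow> x < R \<Longrightarrow> \<phi> x - \<phi> (2 * x) \<le> D" and R: "0 < R"
  shows "set_integrable lebesgue (ball (0 :: 'a::euclidean_space) R) (radial \<phi>)"
    and "(LINT x:ball (0 :: 'a) R|lebesgue. \<bar>radial \<phi> x - \<phi> R\<bar>) \<le> 2 * D * measure lebesgue (ball (0 :: 'a) R)"
proof -
  have D0: "0 \<le> D"
    using D[of "R/2"] R monotone_onD[OF anti, of "R/2" R] by simp
  let ?h = "\<lambda>x::'a. indicator (ball 0 R) x *\<^sub>R (radial \<phi> x - \<phi> R)"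
  note bd = radial_nn_integral_ball[OF anti cont D R, where 'a='a]
  have "?h \<in> borel_measurable lebesgue"
    by (intro borel_measurable_scaleR borel_measurable_diff radial_measurable[OF cont] borel_measurable_indicator) auto
  moreover have "(\<integral>\<^sup>+x. ennreal (norm (?h x)) \<partial>lebesgue) < \<infinity>"
    using le_less_trans[OF bd ennreal_less_top] by simp
  ultimately have "integrable lebesgue ?h" by (rule integrableI_bounded)
  then have "set_integrable lebesgue (ball (0 :: 'a) R) (\<lambda>x. radial \<phi> x - \<phi> R)"
    unfolding set_integrable_def .
  moreover have "set_integrable lebesgue (ball (0 :: 'a) R) (\<lambda>x. \<phi> R)"
    by (rule set_integrable_const_fmeasurable) simp
  ultimately show "set_integrable lebesgue (ball (0 :: 'a) R) (radial \<phi>)"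
    using set_integral_add(1) by fastforce
  have "(LINT x|lebesgue. \<bar>?h x\<bar>) \<le> 2 * D * measure lebesgue (ball (0 :: 'a) R)"
    using bd D0 by (intro integral_real_bounded) auto
  then show "(LINT x:ball (0 :: 'a) R|lebesgue. \<bar>radial \<phi> x - \<phi> R\<bar>) \<le> 2 * D * measure lebesgue (ball (0 :: 'a) R)"
    unfolding set_lebesgue_integral_def by (simp add: abs_mult)
qed

section \<open>Oscillation of radial functions on cubes\<close>

lemma norm_diff_corner_le:
  fixes a :: "real^'n"
  assumes "x \<in> box a (a + (\<chi> i. l))"
  shows "norm (x - a) \<le> real CARD('n) * l"
proof -
  have "norm (x - a) \<le> (\<Sum>i\<in>UNIV. \<bar>(x - a) $ i\<bar>)" by (rule norm_le_l1_cart)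
  also have "\<dots> \<le> (\<Sum>i\<in>(UNIV :: 'n set). l)"
  proof (rule sum_mono)
    fix i
    have "a $ i < x $ i" "x $ i < a $ i + l" using assms by (auto simp: mem_box_cart)
    then show "\<bar>(x - a) $ i\<bar> \<le> l" by simp
  qed
  finally show ?thesis by simp
qed

text \<open>A cube with corner \<open>a\<close> and side \<open>l\<close> counts as near if |a|
  \<le> 2nl. A near cube lies in a ball about the origin of comparable volume, where dyadic
  summation applies. A far cube lies in an annulus between radii \<rho> and 4\<rho>, controlled by
  two doublings; when \<rho> is bounded away from 0, uniform continuity gives smallness.\<close>

theorem radial_in_VMO:
  fixes \<phi> :: "real \<Rightarrow> real"
  assumes anti: "antimono_on {0<..} \<phi>" and cont: "continuous_on {0<..} \<phi>"
    and nonneg: "\<And>x. 0 < x \<Longrightarrow> 0 \<le> \<phi> x"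
    and M: "\<And>x. 0 < x \<Longrightarrow> \<phi> x - \<phi> (2 * x) \<le> M"
    and small: "\<And>\<epsilon>. 0 < \<epsilon> \<Longrightarrow> \<exists>\<delta>>0. \<forall>x. 0 < x \<and> x < \<delta> \<longrightarrow> \<phi> x - \<phi> (2 * x) \<le> \<epsilon>"
  shows "(radial \<phi> :: real^'n \<Rightarrow> real) \<in> VMO"
proof -
  let ?g = "radial \<phi> :: real^'n \<Rightarrow> real"
  define n where "n = real CARD('n)"
  have n: "1 \<le> n" unfolding n_def by (simp add: Suc_leI)
  \<comment> \<open>\<open>K / 2\<close> is twice the volume of a ball of radius
    \<open>4 * (n * l)\<close> divided by that of the cube; the remaining factor 2 comes from
    \<open>mean_osc_le\<close>.\<close>
  define K where "K = 4 * unit_ball_vol (real CARD('n)) * (4 * n) ^ CARD('n)"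
  have K: "0 \<le> K" unfolding K_def using n by simp
  have M0: "0 \<le> M"
    using M[of 1] monotone_onD[OF anti, of 1 2] by simp
  have int: "set_integrable lebesgue Q ?g" if Q: "is_cube Q" for Q
  proof -
    obtain a l where al: "Q = box a (a + (\<chi> i. l))" "Q \<in> lmeasurable" using is_cubeE[OF Q] by metis
    have "bounded Q" unfolding al by simp
    then obtain R where "0 < R" "Q \<subseteq> ball 0 R" using bounded_subset_ballD by blast
    then show ?thesis
      using al(2) by (intro set_integrable_subset[OF radial_integral_ball(1)[OF anti cont M]]) auto
  qed
  have near: "mean_osc ?g Q \<le> K * D"
    if Q: "is_cube Q" "Q = box a (a + (\<chi> i. l))" "0 < l" and a: "norm a \<le> 2 * (n * l)"
      and D: "\<And>x. 0 < x \<Longrightarrow> x < 4 * (n * l) \<Longrightarrow> \<phi> x - \<phi> (2 * x) \<le> D" for Q a l D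
  proof -
    let ?R = "4 * (n * l)"
    have R: "0 < ?R" using n Q by simp
    have sub: "Q \<subseteq> ball 0 ?R"
    proof
      fix x assume "x \<in> Q"
      then have "norm (x - a) \<le> n * l" using norm_diff_corner_le[of x a l] Q by (simp add: n_def)
      then have "norm x \<le> 3 * (n * l)" using a norm_triangle_sub[of x a] by linarith
      then have "norm x < ?R" using R by linarith
      then show "x \<in> ball 0 ?R" by simp
    qed
    have bi: "set_integrable lebesgue (ball 0 ?R) (\<lambda>x. \<bar>?g x - \<phi> ?R\<bar>)"
      by (intro set_integrable_abs set_integral_diff radial_integral_ball(1)[OF anti cont D R]
          set_integrable_const_fmeasurable) auto
    have "(LINT x:Q|lebesgue. \<bar>?g x - \<phi> ?R\<bar>) \<le> (LINT x:ball 0 ?R|lebesgue. \<bar>?g x - \<phi> ?R\<bar>)"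
      unfolding set_lebesgue_integral_def
    proof (rule integral_mono)
      show "integrable lebesgue (\<lambda>x. indicat_real (ball 0 ?R) x *\<^sub>R \<bar>?g x - \<phi> ?R\<bar>)"
        using bi unfolding set_integrable_def .
      show "integrable lebesgue (\<lambda>x. indicat_real Q x *\<^sub>R \<bar>?g x - \<phi> ?R\<bar>)"
        using set_integrable_subset[OF bi _ sub] Q(2) unfolding set_integrable_def by simp
      show "indicat_real Q x *\<^sub>R \<bar>?g x - \<phi> ?R\<bar> \<le> indicat_real (ball 0 ?R) x *\<^sub>R \<bar>?g x - \<phi> ?R\<bar>" for x
        using sub by (auto simp: indicator_def)
    qed
    also have "\<dots> \<le> 2 * D * measure lebesgue (ball (0 :: real^'n) ?R)"
      by (rule radial_integral_ball(2)[OF anti cont D R])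
    also have "\<dots> = K * D / 2 * measure lebesgue Q"
      using R Q(3) measure_cube[OF Q(3), of a] unfolding Q(2)
      by (simp add: content_ball K_def power_mult_distrib)
    finally have "mean_osc ?g Q \<le> 2 * (K * D / 2)" by (rule mean_osc_le[OF Q(1) int[OF Q(1)]])
    then show ?thesis by simp
  qed
  have far: "mean_osc ?g Q \<le> 2 * (\<phi> \<rho> - \<phi> (\<rho> + 2 * (n * l)))"
    if Q: "is_cube Q" "Q = box a (a + (\<chi> i. l))" "0 < l" and \<rho>: "\<rho> = norm a - n * l" "0 < \<rho>" for Q a l \<rho>
  proof (rule mean_osc_le[OF Q(1) int[OF Q(1)]])
    let ?b = "\<phi> \<rho> - \<phi> (\<rho> + 2 * (n * l))"
    have Qm: "Q \<in> lmeasurable" unfolding Q by simp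
    have ci: "set_integrable lebesgue Q (\<lambda>x. k :: real)" for k by (rule set_integrable_const_fmeasurable[OF Qm])
    have "(LINT x:Q|lebesgue. \<bar>?g x - \<phi> \<rho>\<bar>) \<le> (LINT x:Q|lebesgue. ?b)"
    proof (rule set_integral_mono)
      fix x assume "x \<in> Q"
      then have "norm (x - a) \<le> n * l" using norm_diff_corner_le[of x a l] Q by (simp add: n_def)
      then have x: "\<rho> \<le> norm x" "norm x \<le> \<rho> + 2 * (n * l)"
        using \<rho> norm_triangle_sub[of x a] norm_triangle_sub[of a x]
        unfolding norm_minus_commute[of a x] by linarith+
      then have "\<phi> (norm x) \<le> \<phi> \<rho>" "\<phi> (\<rho> + 2 * (n * l)) \<le> \<phi> (norm x)"
        using \<rho> by (auto intro!: monotone_onD[OF anti])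
      then show "\<bar>?g x - \<phi> \<rho>\<bar> \<le> ?b" using x \<rho> by (auto simp: radial_def)
    qed (intro ci set_integrable_abs set_integral_diff int[OF Q(1)])+
    also have "\<dots> = ?b * measure lebesgue Q"
      using Qm unfolding set_lebesgue_integral_def by simp
    finally show "(LINT x:Q|lebesgue. \<bar>?g x - \<phi> \<rho>\<bar>) \<le> ?b * measure lebesgue Q" .
  qed
  \<comment> \<open>Far means nl < \<rho>, hence \<rho> + 2nl < 4\<rho>.\<close>
  have far4: "\<phi> \<rho> - \<phi> (\<rho> + 2 * (n * l)) \<le> 2 * D"
    if "0 < l" "\<rho> = norm a - n * l" "\<not> norm a \<le> 2 * (n * l)"
      "\<phi> \<rho> - \<phi> (2 * \<rho>) \<le> D" "\<phi> (2 * \<rho>) - \<phi> (2 * (2 * \<rho>)) \<le> D" for l \<rho> D and a :: "real^'n"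
  proof -
    have "0 < n * l" using n that by simp
    then have "0 < \<rho> + 2 * (n * l)" "\<rho> + 2 * (n * l) \<le> 2 * (2 * \<rho>)" using that(2,3) by linarith+
    then have "\<phi> (2 * (2 * \<rho>)) \<le> \<phi> (\<rho> + 2 * (n * l))"
      by (intro monotone_onD[OF anti]) auto
    then show ?thesis using that by linarith
  qed
  have pos: "0 < norm a - n * l" if "0 < l" "\<not> norm a \<le> 2 * (n * l)" for l and a :: "real^'n"
    using that n mult_pos_pos[of n l] by linarith
  show ?thesis unfolding VMO_iff
  proof (intro conjI allI impI)
    show "\<exists>B. \<forall>Q. is_cube Q \<longrightarrow> mean_osc ?g Q \<le> B"
    proof (intro exI[of _ "K * M + 4 * M"] allI impI)
      fix Q :: "(real^'n) set" assume Q: "is_cube Q"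
      obtain a l where al: "0 < l" "Q = box a (a + (\<chi> i. l))" using is_cubeE[OF Q] by metis
      show "mean_osc ?g Q \<le> K * M + 4 * M"
      proof (cases "norm a \<le> 2 * (n * l)")
        case True
        have "mean_osc ?g Q \<le> K * M" by (rule near[OF Q al(2,1) True M])
        then show ?thesis using M0 by simp
      next
        case False
        note p = pos[OF al(1) False]
        have "mean_osc ?g Q \<le> 2 * (2 * M)"
          using far[OF Q al(2,1) refl p] far4[OF al(1) refl False M[OF p] M] p by fastforce
        then show ?thesis using M0 K by (simp add: add_increasing)
      qed
    qed
  next
    fix \<epsilon> :: real assume \<epsilon>: "0 < \<epsilon>"
    \<comment> \<open>One bound \<open>e\<close> serves both kinds of cubes: near ones oscillate by
      at most \<open>K * e\<close>, far ones by at most \<open>4 * e\<close>.\<close>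
    define e where "e = \<epsilon> / (K + 4)"
    have e: "0 < e" "K * e \<le> \<epsilon>" "4 * e \<le> \<epsilon>" using \<epsilon> K by (auto simp: e_def field_simps)
    obtain \<delta>1 where \<delta>1: "0 < \<delta>1" "\<And>x. 0 < x \<Longrightarrow> x < \<delta>1 \<Longrightarrow> \<phi> x - \<phi> (2 * x) \<le> e"
      using small[OF e(1)] by blast
    obtain \<delta>2 where \<delta>2: "0 < \<delta>2" "\<And>x y. \<delta>1 / 2 \<le> x \<Longrightarrow> x \<le> y \<Longrightarrow> y \<le> x + \<delta>2 \<Longrightarrow> \<phi> x - \<phi> y \<le> e"
      using antimono_on_uniformly_continuous[OF anti nonneg cont, of "\<delta>1 / 2" e] e \<delta>1(1) by auto
    \<comment> \<open>Sides up to \<open>\<Lambda>\<close> keep the ball around near cubes within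
      radius \<open>\<delta>1\<close> and the annulus of far cubes no wider than
      \<open>\<delta>2\<close>.\<close>
    define \<Lambda> where "\<Lambda> = min (\<delta>1 / (4 * n)) (\<delta>2 / (2 * n))"
    have \<Lambda>: "0 < \<Lambda>" using \<delta>1 \<delta>2 n by (simp add: \<Lambda>_def)
    show "\<exists>\<delta>>0. \<forall>Q. is_cube Q \<and> measure lebesgue Q \<le> \<delta> \<longrightarrow> mean_osc ?g Q \<le> \<epsilon>"
    proof (intro exI[of _ "\<Lambda> ^ CARD('n)"] conjI allI impI)
      show "0 < \<Lambda> ^ CARD('n)" using \<Lambda> by simp
      fix Q :: "(real^'n) set" assume "is_cube Q \<and> measure lebesgue Q \<le> \<Lambda> ^ CARD('n)"
      then have Q: "is_cube Q" and Q\<Lambda>: "measure lebesgue Q \<le> \<Lambda> ^ CARD('n)" by auto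
      obtain a l where al: "0 < l" "Q = box a (a + (\<chi> i. l))" "measure lebesgue Q = l ^ CARD('n)"
        using is_cubeE[OF Q] by metis
      have "l \<le> \<Lambda>" using Q\<Lambda> al \<Lambda> by (simp add: power_mono_iff)
      then have l: "4 * (n * l) \<le> \<delta>1" "2 * (n * l) \<le> \<delta>2"
        using n by (auto simp: \<Lambda>_def field_simps)
      show "mean_osc ?g Q \<le> \<epsilon>"
      proof (cases "norm a \<le> 2 * (n * l)")
        case True
        have "mean_osc ?g Q \<le> K * e" by (rule near[OF Q al(2,1) True]) (use l \<delta>1 in auto)
        then show ?thesis using e by simp
      next
        case False
        define \<rho> where "\<rho> = norm a - n * l"
        have p: "0 < \<rho>" using pos[OF al(1) False] by (simp add: \<rho>_def)
        have "\<phi> \<rho> - \<phi> (\<rho> + 2 * (n * l)) \<le> 2 * e"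
        \<comment> \<open>Below \<open>\<delta>1 / 2\<close> both \<rho> and 2\<rho> are less than
          \<open>\<delta>1\<close>, as two doublings require.\<close>
        proof (cases "\<rho> < \<delta>1 / 2")
          case True
          then show ?thesis using p by (intro far4[OF al(1) \<rho>_def False] \<delta>1(2)) auto
        next
          case rho: False
          then have "\<phi> \<rho> - \<phi> (\<rho> + 2 * (n * l)) \<le> e"
            using l n al(1) by (intro \<delta>2(2)) auto
          then show ?thesis using e by simp
        qed
        then show ?thesis using far[OF Q al(2,1) \<rho>_def p] e by simp
      qed
    qed
  qed (use int in auto)
qed

subsection \<open>The decreasing rearrangement\<close>

lemma decr_rearr_nonneg: "0 \<le> decr_rearr f s"
  unfolding decr_rearr_def by simp

lemma distr_fun_antimono:
  fixes f :: "real^'n \<Rightarrow> real"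
  assumes "f \<in> borel_measurable lebesgue" "\<alpha> \<le> \<beta>"
  shows "distr_fun f \<beta> \<le> distr_fun f \<alpha>"
  unfolding distr_fun_def
proof (rule emeasure_mono)
  have "{x \<in> space lebesgue. \<bar>f x\<bar> > \<alpha>} \<in> sets lebesgue" using assms(1) by measurable
  then show "{x. \<bar>f x\<bar> > \<alpha>} \<in> sets lebesgue" by simp
qed (use assms in auto)

text \<open>The set of levels defining \<open>decr_rearr\<close> is closed downward in the
  nonnegative reals. If nonempty, it is an interval starting at 0, so its length decides which
  levels it contains, up to the endpoint. Later proofs bridge the weak inequality by inserting
  intermediate levels.\<close>

lemma rearrangeable_levels:
  fixes f :: "real^'n \<Rightarrow> real"
  assumes f: "rearrangeable f" and s: "0 < s" and \<alpha>: "0 \<le> \<alpha>"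
  shows less_decr_rearrD: "\<alpha> < decr_rearr f s \<Longrightarrow> ennreal s < distr_fun f \<alpha>"
    and le_decr_rearrI: "ennreal s < distr_fun f \<alpha> \<Longrightarrow> \<alpha> \<le> decr_rearr f s"
proof -
  define A where "A = {\<alpha>::real. 0 \<le> \<alpha> \<and> distr_fun f \<alpha> > ennreal s}"
  have fm: "f \<in> borel_measurable lebesgue" using f unfolding rearrangeable_def by simp
  have down: "x \<in> A" if "y \<in> A" "0 \<le> x" "x \<le> y" for x y
    using that distr_fun_antimono[OF fm, of x y] unfolding A_def by (auto intro: less_le_trans)
  \<comment> \<open>Boundedness of \<open>A\<close> matters because \<open>measure\<close> returns 0
    on sets of infinite measure.\<close>
  have "\<forall>\<^sub>F \<alpha> in at_top. distr_fun f \<alpha> < ennreal s"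
    using f s unfolding rearrangeable_def by (intro order_tendstoD) auto
  then obtain b where "\<And>\<alpha>. b \<le> \<alpha> \<Longrightarrow> distr_fun f \<alpha> < ennreal s" unfolding eventually_at_top_linorder by blast
  then have b: "\<not> ennreal s < distr_fun f \<alpha>" if "b \<le> \<alpha>" for \<alpha> using that by (meson less_asym)
  have sub: "A \<subseteq> {0..b}"
  proof
    fix x assume "x \<in> A"
    then have "0 \<le> x" "\<not> b \<le> x" using b[of x] unfolding A_def by auto
    then show "x \<in> {0..b}" by simp
  qed
  have "is_interval A" unfolding is_interval_1
  proof (intro ballI allI impI)
    fix a b x assume "a \<in> A" "b \<in> A" "a \<le> x \<and> x \<le> b"
    then show "x \<in> A" by (intro down[of b x]) (auto simp: A_def)
  qed
  then have Am: "A \<in> lmeasurable"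
    using sub by (intro measurable_convex bounded_subset[OF bounded_closed_interval]) (auto simp: is_interval_convex)
  have eq: "decr_rearr f s = measure lebesgue A" unfolding decr_rearr_def A_def ..
  show "ennreal s < distr_fun f \<alpha>" if less: "\<alpha> < decr_rearr f s"
  proof (rule ccontr)
    assume n: "\<not> ennreal s < distr_fun f \<alpha>"
    have "A \<subseteq> {0..\<alpha>}"
    proof
      fix x assume x: "x \<in> A"
      then have "0 \<le> x" by (simp add: A_def)
      moreover have "x \<le> \<alpha>"
      proof (rule ccontr)
        assume "\<not> x \<le> \<alpha>"
        then have "\<alpha> \<in> A" using down[OF x, of \<alpha>] \<alpha> by simp
        then show False using n by (simp add: A_def)
      qed
      ultimately show "x \<in> {0..\<alpha>}" by simp
    qed
    then have "measure lebesgue A \<le> measure lebesgue {0..\<alpha>}"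
      using Am by (intro measure_mono_fmeasurable) auto
    then show False using less eq \<alpha> by simp
  qed
  show "\<alpha> \<le> decr_rearr f s" if "ennreal s < distr_fun f \<alpha>"
  proof -
    have "\<alpha> \<in> A" using that \<alpha> by (simp add: A_def)
    then have "{0..\<alpha>} \<subseteq> A" using down by auto
    then have "measure lebesgue {0..\<alpha>} \<le> measure lebesgue A"
      using Am by (intro measure_mono_fmeasurable) auto
    then show ?thesis using eq \<alpha> by simp
  qed
qed

lemma decr_rearr_antimono:
  assumes f: "rearrangeable f"
  shows "antimono_on {0<..} (decr_rearr f)"
proof (rule monotone_onI)
  fix s t :: real assume st: "s \<in> {0<..}" "t \<in> {0<..}" "s \<le> t"
  show "decr_rearr f t \<le> decr_rearr f s"
  proof (rule ccontr)
    assume "\<not> ?thesis"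
    then obtain \<alpha> where \<alpha>: "decr_rearr f s < \<alpha>" "\<alpha> < decr_rearr f t" using dense not_le by blast
    have "0 \<le> \<alpha>" using \<alpha>(1) decr_rearr_nonneg[of f s] by linarith
    have "ennreal s \<le> ennreal t" using st by (intro ennreal_leI) auto
    also have "ennreal t < distr_fun f \<alpha>" using \<alpha>(2) st \<open>0 \<le> \<alpha>\<close> by (intro less_decr_rearrD[OF f]) auto
    finally have "\<alpha> \<le> decr_rearr f s" using st \<open>0 \<le> \<alpha>\<close> by (intro le_decr_rearrI[OF f]) auto
    then show False using \<alpha> by simp
  qed
qed

section \<open>Superlevel sets of f and the oscillation forced by a gap between levels\<close>

lemma level_sets_lmeasurable:
  fixes f :: "real^'n \<Rightarrow> real"
  assumes "f \<in> borel_measurable lebesgue" "distr_fun f \<alpha> \<le> ennreal s" "0 \<le> s"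
  shows "{x. \<alpha> < \<bar>f x\<bar>} \<in> lmeasurable" "measure lebesgue {x. \<alpha> < \<bar>f x\<bar>} \<le> s"
proof -
  have "{x \<in> space lebesgue. \<bar>f x\<bar> > \<alpha>} \<in> sets lebesgue" using assms(1) by measurable
  then show m: "{x. \<alpha> < \<bar>f x\<bar>} \<in> lmeasurable"
    using assms(2) unfolding distr_fun_def by (intro fmeasurableI) (auto intro: le_less_trans ennreal_less_top)
  show "measure lebesgue {x. \<alpha> < \<bar>f x\<bar>} \<le> s"
    using assms(2,3) m unfolding distr_fun_def by (simp add: emeasure_eq_measure2)
qed

text \<open>\<open>mean_osc_ge\<close> is applied to a cube about \<open>x\<close>; the powers of
  \<open>t\<close> cancel, so the lower bound on the oscillation is scale free. The sets are
  measured in the ball of radius \<open>2 * t\<close> because their dense parts may sit in two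
  adjacent balls of radius \<open>t\<close>.\<close>

lemma level_gap_le_mean_osc:
  fixes f :: "real^'n \<Rightarrow> real"
  assumes f: "\<And>Q. is_cube Q \<Longrightarrow> set_integrable lebesgue Q f" and t: "0 < t" and le: "\<alpha> \<le> \<beta>"
    and E: "E \<in> sets lebesgue" "\<And>x. x \<in> E \<Longrightarrow> \<beta> \<le> \<bar>f x\<bar>"
      "\<theta> * measure lebesgue (cball x t) \<le> measure lebesgue (E \<inter> cball x (2 * t))"
    and F: "F \<in> sets lebesgue" "\<And>x. x \<notin> F \<Longrightarrow> \<bar>f x\<bar> \<le> \<alpha>"
      "\<theta> * measure lebesgue (cball x t) \<le> measure lebesgue (cball x (2 * t) - F)"
  obtains Q where "is_cube Q" "measure lebesgue Q = (6 * t) ^ CARD('n)"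
    "(\<beta> - \<alpha>) * (\<theta> * unit_ball_vol (real CARD('n))) \<le> 2 * 6 ^ CARD('n) * mean_osc f Q"
proof -
  \<comment> \<open>The half-side \<open>3 * t\<close> makes the open cube contain the closed ball
    of radius \<open>2 * t\<close>.\<close>
  define a where "a = x - (\<chi> i. 3 * t)"
  define Q where "Q = box a (a + (\<chi> i. 6 * t))"
  have Q: "is_cube Q" unfolding Q_def is_cube_def using t by (intro exI[of _ a] exI[of _ "6 * t"]) simp
  have Qm: "measure lebesgue Q = (6 * t) ^ CARD('n)" unfolding Q_def using t by (intro measure_cube) simp
  have Ql: "Q \<in> lmeasurable" unfolding Q_def by simp
  have sub: "cball x (2 * t) \<subseteq> Q"
  proof
    fix y assume "y \<in> cball x (2 * t)"
    then have "norm (y - x) \<le> 2 * t" by (simp add: dist_norm norm_minus_commute)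
    then have "\<bar>y $ i - x $ i\<bar> \<le> 2 * t" for i using component_le_norm_cart[of "y - x" i] by simp
    then have "\<bar>y $ i - x $ i\<bar> < 3 * t" for i by (rule le_less_trans) (use t in simp)
    then show "y \<in> Q" unfolding Q_def a_def mem_box_cart by (auto simp: abs_less_iff algebra_simps)
  qed
  let ?m = "\<theta> * measure lebesgue (cball x t)"
  have "measure lebesgue (E \<inter> cball x (2 * t)) \<le> measure lebesgue (Q \<inter> E)"
    using sub E Ql by (intro measure_mono_fmeasurable fmeasurable_Int_fmeasurable) auto
  moreover have "measure lebesgue (cball x (2 * t) - F) \<le> measure lebesgue (Q - F)"
    using sub F Ql by (intro measure_mono_fmeasurable fmeasurable_Diff) auto
  ultimately have "(\<beta> - \<alpha>) * ?m \<le> 2 * measure lebesgue Q * mean_osc f Q"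
    using E F by (intro mean_osc_ge[OF Q f[OF Q], of E _ \<beta> F] le) auto
  then have "((\<beta> - \<alpha>) * (\<theta> * unit_ball_vol (real CARD('n)))) * t ^ CARD('n)
      \<le> (2 * 6 ^ CARD('n) * mean_osc f Q) * t ^ CARD('n)"
    using t unfolding Qm by (simp add: content_cball power_mult_distrib mult_ac)
  then have "(\<beta> - \<alpha>) * (\<theta> * unit_ball_vol (real CARD('n))) \<le> 2 * 6 ^ CARD('n) * mean_osc f Q"
    using t by (simp add: mult_le_cancel_right)
  then show thesis using that Q Qm by blast
qed

text \<open>The ball found has radius at most \<open>80 r\<close>, and the cube around it is six times as long; hence \<open>480\<close>.\<close>

lemma decr_rearr_doubling_le:
  fixes f :: "real^'n \<Rightarrow> real"
  assumes f: "rearrangeable f" "\<And>Q. is_cube Q \<Longrightarrow> set_integrable lebesgue Q f" and r: "0 < r"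
    and b: "\<And>Q. is_cube Q \<Longrightarrow> measure lebesgue Q \<le> (480 * r) ^ CARD('n) \<Longrightarrow> mean_osc f Q \<le> b"
  defines "\<omega> \<equiv> unit_ball_vol (real CARD('n))"
  shows "decr_rearr f (\<omega> * r ^ CARD('n)) - decr_rearr f (\<omega> * (2 * r) ^ CARD('n))
    \<le> 8 * 60 ^ CARD('n) / \<omega> * b" (is "?\<phi> - ?\<psi> \<le> ?K * b")
proof (rule ccontr)
  assume "\<not> ?thesis"
  then have gap: "0 < ?\<phi> - ?\<psi> - ?K * b" by linarith
  \<comment> \<open>A third of the excess is given up at each end, leaving a gap \<beta> - \<alpha>
    equal to \<open>?K * b + \<eta>\<close>.\<close>
  define \<eta> where "\<eta> = (?\<phi> - ?\<psi> - ?K * b) / 3"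
  define \<alpha> where "\<alpha> = ?\<psi> + \<eta>"
  define \<beta> where "\<beta> = ?\<phi> - \<eta>"
  have fm: "f \<in> borel_measurable lebesgue" using f unfolding rearrangeable_def by simp
  have \<omega>: "0 < \<omega>" by (simp add: \<omega>_def)
  have b0: "0 \<le> b"
  proof -
    have "is_cube (box (0::real^'n) (0 + (\<chi> i. r)))" unfolding is_cube_def using r by blast
    moreover have "r ^ CARD('n) \<le> (480 * r) ^ CARD('n)" using r by (intro power_mono) auto
    then have "measure lebesgue (box (0::real^'n) (0 + (\<chi> i. r))) \<le> (480 * r) ^ CARD('n)"
      using measure_cube[OF r, of "0::real^'n"] by simp
    ultimately show ?thesis using b order_trans[OF mean_osc_nonneg] by blast
  qed
  have Kb: "0 \<le> ?K * b" using b0 \<omega> by simp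
  have \<alpha>: "0 \<le> \<alpha>" "?\<psi> < \<alpha>" "\<beta> < ?\<phi>" "\<alpha> < \<beta>" "?K * b < \<beta> - \<alpha>"
  proof -
    have *: "0 \<le> q + (p - q - c) / 3 \<and> q < q + (p - q - c) / 3 \<and> p - (p - q - c) / 3 < p \<and>
      q + (p - q - c) / 3 < p - (p - q - c) / 3 \<and> c < p - (p - q - c) / 3 - (q + (p - q - c) / 3)"
      if "0 \<le> q" "0 \<le> c" "0 < p - q - c" for p q c :: real
      using that by (simp add: field_simps)
    show "0 \<le> \<alpha>" "?\<psi> < \<alpha>" "\<beta> < ?\<phi>" "\<alpha> < \<beta>" "?K * b < \<beta> - \<alpha>"
      unfolding \<alpha>_def \<beta>_def \<eta>_def using *[OF decr_rearr_nonneg Kb gap] by blast+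
  qed
  let ?s = "\<omega> * r ^ CARD('n)"
  have s: "0 < ?s" "0 < \<omega> * (2 * r) ^ CARD('n)" using \<omega> r by simp_all
  define E where "E = {x. \<beta> < \<bar>f x\<bar>}"
  define F where "F = {x. \<alpha> < \<bar>f x\<bar>}"
  have "distr_fun f \<alpha> \<le> ennreal (\<omega> * (2 * r) ^ CARD('n))"
    using le_decr_rearrI[OF f(1) s(2) \<alpha>(1)] \<alpha>(2) by (meson not_le)
  then have F: "F \<in> lmeasurable" "measure lebesgue F \<le> \<omega> * (2 * r) ^ CARD('n)"
    using level_sets_lmeasurable[OF fm] s unfolding F_def by auto
  have Es: "E \<in> sets lebesgue"
  proof -
    have "{x \<in> space lebesgue. \<bar>f x\<bar> > \<beta>} \<in> sets lebesgue" using fm by measurable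
    then show ?thesis by (simp add: E_def)
  qed
  have "E \<subseteq> F" using \<alpha> by (auto simp: E_def F_def)
  then have E: "E \<in> lmeasurable" using F Es fmeasurableI2 by blast
  have "ennreal ?s < distr_fun f \<beta>" using \<alpha> s by (intro less_decr_rearrD[OF f(1)]) auto
  then have sE: "?s < measure lebesgue E"
    using E s unfolding distr_fun_def E_def[symmetric] by (simp add: emeasure_eq_measure2 ennreal_less_iff)
  define \<theta> :: real where "\<theta> = 1 / (4 * 10 ^ CARD('n))"
  have "1 \<le> 2 * (10 :: real) ^ CARD('n)" using one_le_power[of "10::real" "CARD('n)"] by linarith
  then have \<theta>: "0 < \<theta>" "\<theta> \<le> 1/2" "4 * \<theta> * 10 ^ CARD('n) \<le> 1"
    by (auto simp: \<theta>_def field_simps)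
  \<comment> \<open>Doubling the radius multiplies the volume by \<open>2 ^ CARD('n)\<close>,
    exactly the ratio allowed between \<open>F\<close> and \<open>E\<close>.\<close>
  have "2 ^ CARD('n) * ?s \<le> 2 ^ CARD('n) * measure lebesgue E" using sE by simp
  then have FE: "measure lebesgue F \<le> 2 ^ CARD('n) * measure lebesgue E"
  proof -
    have "\<omega> * (2 * r) ^ CARD('n) = 2 ^ CARD('n) * ?s" by (simp add: power_mult_distrib)
    then show ?thesis using F(2) \<open>2 ^ CARD('n) * ?s \<le> _\<close> by linarith
  qed
  have FE': "measure lebesgue F \<le> 2 ^ DIM(real^'n) * measure lebesgue E" using FE by simp
  have \<theta>': "4 * \<theta> * 10 ^ DIM(real^'n) \<le> 1" using \<theta>(3) by simp
  have E0: "0 < measure lebesgue E" using sE s by linarith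
  obtain x t where t: "0 < t" and tE: "\<theta> * measure lebesgue (cball x t) < measure lebesgue (E \<inter> cball x t)"
    and tF: "measure lebesgue (cball x t) \<le> 2 * measure lebesgue (cball x t - F)"
    using exists_cball_meeting_both[OF E F(1) E0 FE' \<theta>(1) \<theta>'] by metis
  have bt: "measure lebesgue (cball x t) = \<omega> * t ^ CARD('n)" using t by (simp add: content_cball \<omega>_def)
  have sub: "cball x t \<subseteq> cball x (2 * t)" using t by auto
  obtain Q where Q: "is_cube Q" "measure lebesgue Q = (6 * t) ^ CARD('n)"
    "(\<beta> - \<alpha>) * (\<theta> * \<omega>) \<le> 2 * 6 ^ CARD('n) * mean_osc f Q"
    unfolding \<omega>_def
  proof (rule level_gap_le_mean_osc[OF f(2) t, of \<alpha> \<beta> E \<theta> x F])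
    have "measure lebesgue (E \<inter> cball x t) \<le> measure lebesgue (E \<inter> cball x (2 * t))"
      using sub Es by (intro measure_mono_fmeasurable fmeasurable_Int_fmeasurable E) auto
    then show "\<theta> * measure lebesgue (cball x t) \<le> measure lebesgue (E \<inter> cball x (2 * t))" using tE by simp
    have "\<theta> * measure lebesgue (cball x t) \<le> 1/2 * measure lebesgue (cball x t)"
      using \<theta> by (intro mult_right_mono) auto
    also have "\<dots> \<le> measure lebesgue (cball x t - F)" using tF by simp
    also have "\<dots> \<le> measure lebesgue (cball x (2 * t) - F)"
      using sub F(1) by (intro measure_mono_fmeasurable fmeasurable_Diff) auto
    finally show "\<theta> * measure lebesgue (cball x t) \<le> measure lebesgue (cball x (2 * t) - F)" .
  qed (use \<alpha> Es F E_def F_def in auto)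
  \<comment> \<open>Density in a set of bounded measure limits the radius. The factor 4 is absorbed
    as \<open>4 \<le> 4 ^ CARD('n)\<close>, and 4 * 10 * 2 = 80.\<close>
  have "\<theta> * (\<omega> * t ^ CARD('n)) < measure lebesgue (E \<inter> cball x t)" using tE bt by simp
  also have "\<dots> \<le> measure lebesgue F"
    using \<open>E \<subseteq> F\<close> F Es by (intro measure_mono_fmeasurable) auto
  also have "\<dots> \<le> \<omega> * (2 * r) ^ CARD('n)" by (rule F(2))
  finally have "t ^ CARD('n) \<le> 4 * (10 ^ CARD('n) * (2 * r) ^ CARD('n))"
    using \<omega> by (simp add: \<theta>_def field_simps)
  also have "\<dots> \<le> 4 ^ CARD('n) * (10 ^ CARD('n) * (2 * r) ^ CARD('n))"
    using r self_le_power[of "4::real" "CARD('n)"] by (intro mult_right_mono) auto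
  also have "\<dots> = (4 * (10 * (2 * r))) ^ CARD('n)" by (simp only: power_mult_distrib)
  also have "\<dots> = (80 * r) ^ CARD('n)" by simp
  finally have "t ^ CARD('n) \<le> (80 * r) ^ CARD('n)" .
  then have "t \<le> 80 * r" by (subst (asm) power_mono_iff) (use r t in auto)
  then have "measure lebesgue Q \<le> (480 * r) ^ CARD('n)"
    unfolding Q(2) using t by (intro power_mono) auto
  then have "mean_osc f Q \<le> b" using b Q(1) by blast
  then have "2 * 6 ^ CARD('n) * mean_osc f Q \<le> 2 * 6 ^ CARD('n) * b" by (intro mult_left_mono) auto
  then have "(\<beta> - \<alpha>) * (\<theta> * \<omega>) \<le> 2 * 6 ^ CARD('n) * b" using Q(3) by linarith
  then have "\<beta> - \<alpha> \<le> 8 * (6 ^ CARD('n) * 10 ^ CARD('n)) / \<omega> * b"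
    using \<omega> by (simp add: \<theta>_def field_simps)
  also have "6 ^ CARD('n) * 10 ^ CARD('n) = (60 :: real) ^ CARD('n)"
    using power_mult_distrib[of "6::real" 10 "CARD('n)"] by simp
  finally show False using \<alpha>(5) by simp
qed

text \<open>Right continuity comes directly from the level relations. A jump from the left would
  give levels \<alpha> < \<beta> whose superlevel sets differ by a null set. Adjacent small balls,
  one dense in this set and one not, then force oscillation bounded below on arbitrarily small
  cubes.\<close>

lemma decr_rearr_continuous:
  fixes f :: "real^'n \<Rightarrow> real"
  assumes f: "f \<in> VMO" "rearrangeable f"
  shows "continuous_on {0<..} (decr_rearr f)"
proof -
  have fm: "f \<in> borel_measurable lebesgue" using f unfolding rearrangeable_def by simp
  have fi: "\<And>Q. is_cube Q \<Longrightarrow> set_integrable lebesgue Q f" using f(1) unfolding VMO_iff by blast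
  define \<omega> where "\<omega> = unit_ball_vol (real CARD('n))"
  have \<omega>: "0 < \<omega>" by (simp add: \<omega>_def)
  have left: "\<exists>s1>0. s1 < s \<and> decr_rearr f s1 < a" if s: "0 < s" and a: "decr_rearr f s < a" for s a
  proof (rule ccontr)
    assume "\<not> ?thesis"
    then have H: "a \<le> decr_rearr f s1" if "0 < s1" "s1 < s" for s1 using that by force
    obtain \<alpha> where \<alpha>: "decr_rearr f s < \<alpha>" "\<alpha> < a" using a dense by blast
    obtain \<beta> where \<beta>: "\<alpha> < \<beta>" "\<beta> < a" using \<alpha>(2) dense by blast
    have \<alpha>0: "0 \<le> \<alpha>" using \<alpha>(1) decr_rearr_nonneg[of f s] by linarith
    define E where "E = {x. \<beta> < \<bar>f x\<bar>}"
    define F where "F = {x. \<alpha> < \<bar>f x\<bar>}"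
    have "distr_fun f \<alpha> \<le> ennreal s"
      using le_decr_rearrI[OF f(2) s \<alpha>0] \<alpha>(1) by (meson not_le)
    then have F: "F \<in> lmeasurable" "measure lebesgue F \<le> s"
      using level_sets_lmeasurable[OF fm] s unfolding F_def by auto
    have Es: "E \<in> sets lebesgue"
    proof -
      have "{x \<in> space lebesgue. \<bar>f x\<bar> > \<beta>} \<in> sets lebesgue" using fm by measurable
      then show ?thesis by (simp add: E_def)
    qed
    have EF: "E \<subseteq> F" using \<beta> by (auto simp: E_def F_def)
    then have E: "E \<in> lmeasurable" using F Es fmeasurableI2 by blast
    \<comment> \<open>Letting \<open>s1\<close> tend to \<open>s\<close> gives |E| \<ge> s \<ge>
      |F|, so \<open>F - E\<close> is null.\<close>
    have "s1 < measure lebesgue E" if "0 < s1" "s1 < s" for s1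
    proof -
      have "ennreal s1 < distr_fun f \<beta>"
        using \<alpha>0 \<beta> that H[OF that] by (intro less_decr_rearrD[OF f(2)]) auto
      then show ?thesis
        using E that unfolding distr_fun_def E_def[symmetric] by (simp add: emeasure_eq_measure2 ennreal_less_iff)
    qed
    then have sE: "s \<le> measure lebesgue E" by (intro dense_le_bounded[OF s] less_imp_le)
    then have E0: "0 < measure lebesgue E" using s by linarith
    have null: "measure lebesgue (F - E) = 0"
    proof -
      have "measure lebesgue (F - E) = measure lebesgue F - measure lebesgue E"
        using E F EF by (intro measurable_measure_Diff) auto
      then show ?thesis using F(2) sE measure_nonneg[of lebesgue "F - E"] by linarith
    qed
    define \<theta> :: real where "\<theta> = 1 / (4 * 5 ^ CARD('n))"
    have "1 \<le> 2 * (5 :: real) ^ CARD('n)" using one_le_power[of "5::real" "CARD('n)"] by linarith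
    then have \<theta>: "0 < \<theta>" "\<theta> \<le> 1/2" "4 * \<theta> * 5 ^ DIM(real^'n) \<le> 1"
      by (auto simp: \<theta>_def field_simps)
    \<comment> \<open>Half the oscillation that \<open>level_gap_le_mean_osc\<close> forces on the
      cube, whatever its size.\<close>
    define \<epsilon> where "\<epsilon> = (\<beta> - \<alpha>) * (\<theta> * \<omega>) / (4 * 6 ^ CARD('n))"
    have \<epsilon>: "0 < \<epsilon>" using \<beta> \<theta> \<omega> by (simp add: \<epsilon>_def)
    then obtain \<delta> where \<delta>: "0 < \<delta>"
      "\<And>Q :: (real^'n) set. is_cube Q \<Longrightarrow> measure lebesgue Q \<le> \<delta> \<Longrightarrow> mean_osc f Q \<le> \<epsilon>"
      using f(1) unfolding VMO_iff by blast
    \<comment> \<open>The cube has side \<open>6 * t\<close> below both 1 and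
      \<open>\<delta>\<close>, so its volume is at most its side and hence at most
      \<open>\<delta>\<close>.\<close>
    define R where "R = min 1 \<delta> / 6"
    have R: "0 < R" using \<delta> by (simp add: R_def)
    obtain y z t where t: "0 < t" "t < R" "dist y z = t"
      and ty: "\<theta> * measure lebesgue (cball y t) < measure lebesgue (E \<inter> cball y t)"
      and tz: "measure lebesgue (E \<inter> cball z t) \<le> \<theta> * measure lebesgue (cball z t)"
      using exists_adjacent_cballs[OF E E0 \<theta>(1,3) R] by metis
    have sub: "cball y t \<subseteq> cball y (2 * t)" using t(1) by (intro subset_cball) simp
    have subz: "cball z t \<subseteq> cball y (2 * t)"
    proof
      fix w assume "w \<in> cball z t"
      then show "w \<in> cball y (2 * t)" using dist_triangle[of y w z] t by simp
    qed
    have bz: "measure lebesgue (cball z t) = measure lebesgue (cball y t)" using t by (simp add: content_cball)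
    obtain Q where Q: "is_cube Q" "measure lebesgue Q = (6 * t) ^ CARD('n)"
      "(\<beta> - \<alpha>) * (\<theta> * \<omega>) \<le> 2 * 6 ^ CARD('n) * mean_osc f Q"
      unfolding \<omega>_def
    proof (rule level_gap_le_mean_osc[OF fi t(1), of \<alpha> \<beta> E \<theta> y F])
      have "measure lebesgue (E \<inter> cball y t) \<le> measure lebesgue (E \<inter> cball y (2 * t))"
        using sub Es by (intro measure_mono_fmeasurable fmeasurable_Int_fmeasurable E) auto
      then show "\<theta> * measure lebesgue (cball y t) \<le> measure lebesgue (E \<inter> cball y (2 * t))" using ty by simp
      \<comment> \<open>The ball about \<open>z\<close> splits into its part in \<open>E\<close>, a
        null part in \<open>F - E\<close> and the part outside \<open>F\<close>, whose density is
        therefore at least 1 - \<theta> \<ge> \<theta>.\<close>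
      have "measure lebesgue (cball z t)
          = measure lebesgue ((E \<inter> cball z t) \<union> ((cball z t \<inter> (F - E)) \<union> (cball z t - F)))"
        using EF by (intro arg_cong[of _ _ "measure lebesgue"]) auto
      also have "\<dots> \<le> measure lebesgue (E \<inter> cball z t) + measure lebesgue ((cball z t \<inter> (F - E)) \<union> (cball z t - F))"
        using E F by (intro measure_Un_le sets.Un sets.Int sets.Diff) auto
      also have "measure lebesgue ((cball z t \<inter> (F - E)) \<union> (cball z t - F))
          \<le> measure lebesgue (cball z t \<inter> (F - E)) + measure lebesgue (cball z t - F)"
        using E F by (intro measure_Un_le sets.Un sets.Int sets.Diff) auto
      also have "measure lebesgue (cball z t \<inter> (F - E)) \<le> measure lebesgue (F - E)"
        using E F by (intro measure_mono_fmeasurable fmeasurable_Diff) auto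
      also note null
      finally have "(1 - \<theta>) * measure lebesgue (cball y t) \<le> measure lebesgue (cball z t - F)"
        using tz bz by (simp add: algebra_simps)
      moreover have "\<theta> * measure lebesgue (cball y t) \<le> (1 - \<theta>) * measure lebesgue (cball y t)"
        using \<theta> by (intro mult_right_mono) auto
      moreover have "measure lebesgue (cball z t - F) \<le> measure lebesgue (cball y (2 * t) - F)"
        using subz F(1) by (intro measure_mono_fmeasurable fmeasurable_Diff) auto
      ultimately show "\<theta> * measure lebesgue (cball y t) \<le> measure lebesgue (cball y (2 * t) - F)" by linarith
    qed (use \<beta> Es F E_def F_def in auto)
    have "(6 * t) ^ CARD('n) \<le> (6 * t) ^ 1"
      using t by (intro power_decreasing) (auto simp: R_def Suc_leI)
    then have "measure lebesgue Q \<le> \<delta>" using t Q(2) by (simp add: R_def)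
    then have "2 * 6 ^ CARD('n) * mean_osc f Q \<le> 2 * 6 ^ CARD('n) * \<epsilon>"
      using \<delta>(2)[OF Q(1)] by (intro mult_left_mono) auto
    also have "\<dots> = (\<beta> - \<alpha>) * (\<theta> * \<omega>) / 2" by (simp add: \<epsilon>_def)
    finally have "(\<beta> - \<alpha>) * (\<theta> * \<omega>) \<le> (\<beta> - \<alpha>) * (\<theta> * \<omega>) / 2" using Q(3) by linarith
    moreover have "0 < (\<beta> - \<alpha>) * (\<theta> * \<omega>)" using \<beta> \<theta> \<omega> by simp
    ultimately show False by linarith
  qed
  \<comment> \<open>The strict inequality between \<open>s\<close> and the distribution function at
    an intermediate level \<open>b\<close> leaves room for some larger \<open>s1\<close>.\<close>
  have right: "\<exists>s1>s. \<forall>u. 0 < u \<and> u < s1 \<longrightarrow> a < decr_rearr f u"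
    if s: "0 < s" and a: "0 \<le> a" "a < decr_rearr f s" for s a
  proof -
    obtain b where b: "a < b" "b < decr_rearr f s" using a dense by blast
    have "ennreal s < distr_fun f b" using b a s by (intro less_decr_rearrD[OF f(2)]) auto
    then obtain c where c: "ennreal s < c" "c < distr_fun f b" using dense by blast
    then obtain s1 where s1: "c = ennreal s1" "0 \<le> s1" by (cases c) auto
    have "a < decr_rearr f u" if u: "0 < u" "u < s1" for u
    proof -
      have "ennreal u \<le> c" using s1 u by (auto intro: ennreal_leI)
      then have "ennreal u < distr_fun f b" using c(2) by (rule le_less_trans)
      then have "b \<le> decr_rearr f u" using a b u by (intro le_decr_rearrI[OF f(2)]) auto
      then show ?thesis using b by simp
    qed
    moreover have "s < s1" using c(1) s1 s by (simp add: ennreal_less_iff)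
    ultimately show ?thesis by blast
  qed
  have "isCont (decr_rearr f) s" if s: "0 < s" for s
    unfolding isCont_def
  proof (rule order_tendstoI)
    fix a assume a: "a < decr_rearr f s"
    show "\<forall>\<^sub>F u in at s. a < decr_rearr f u"
    proof (cases "0 \<le> a")
      case True
      obtain s1 where s1: "s < s1" "\<And>u. 0 < u \<Longrightarrow> u < s1 \<Longrightarrow> a < decr_rearr f u" using right[OF s True a] by blast
      have "\<forall>\<^sub>F u in at s. u \<in> {0<..<s1}" using s s1 by (intro eventually_at_in_open') auto
      then show ?thesis by eventually_elim (use s1 in auto)
    next
      case False
      then show ?thesis using decr_rearr_nonneg[of f] by (intro always_eventually allI) (meson less_le_trans not_le)
    qed
  next
    fix a assume a: "decr_rearr f s < a"
    obtain s1 where s1: "0 < s1" "s1 < s" "decr_rearr f s1 < a" using left[OF s a] by blast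
    have "\<forall>\<^sub>F u in at s. u \<in> {s1<..}" using s1 by (intro eventually_at_in_open') auto
    then show "\<forall>\<^sub>F u in at s. decr_rearr f u < a"
    proof eventually_elim
      fix u assume "u \<in> {s1<..}"
      then have "decr_rearr f u \<le> decr_rearr f s1"
        using s1 by (intro monotone_onD[OF decr_rearr_antimono[OF f(2)]]) auto
      then show "decr_rearr f u < a" using s1 by simp
    qed
  qed
  then show ?thesis by (intro continuous_at_imp_continuous_on) auto
qed

section \<open>From the rearrangement on the half-line to the radial function on space\<close>

theorem corollary4p4:
  fixes f :: "real^'n \<Rightarrow> real"
  assumes "f \<in> VMO" and "rearrangeable f"
  shows "symm_rearr f \<in> VMO"
proof -
  define \<omega> where "\<omega> = unit_ball_vol (real CARD('n))"
  have \<omega>: "0 < \<omega>" by (simp add: \<omega>_def)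
  define \<phi> where "\<phi> r = decr_rearr f (\<omega> * r ^ CARD('n))" for r
  define K where "K = 8 * 60 ^ CARD('n) / \<omega>"
  have K: "0 < K" using \<omega> by (simp add: K_def)
  have fi: "\<And>Q. is_cube Q \<Longrightarrow> set_integrable lebesgue Q f"
    using assms(1) unfolding VMO_iff by blast
  obtain B where B: "\<And>Q. is_cube Q \<Longrightarrow> mean_osc f Q \<le> B" using assms(1) unfolding VMO_iff by blast
  have doubling: "\<phi> r - \<phi> (2 * r) \<le> K * b"
    if "0 < r" "\<And>Q. is_cube Q \<Longrightarrow> measure lebesgue Q \<le> (480 * r) ^ CARD('n) \<Longrightarrow> mean_osc f Q \<le> b" for r b
    using decr_rearr_doubling_le[OF assms(2) fi that] by (simp add: \<phi>_def K_def \<omega>_def)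
  have "(radial \<phi> :: real^'n \<Rightarrow> real) \<in> VMO"
  proof (rule radial_in_VMO)
    show "antimono_on {0<..} \<phi>"
      unfolding \<phi>_def using \<omega>
      by (intro monotone_onI monotone_onD[OF decr_rearr_antimono[OF assms(2)]] mult_left_mono power_mono) auto
    show "continuous_on {0<..} \<phi>"
      unfolding \<phi>_def
      by (rule continuous_on_compose2[OF decr_rearr_continuous[OF assms]])
        (use \<omega> in \<open>auto intro!: continuous_intros\<close>)
    show "0 \<le> \<phi> x" for x by (simp add: \<phi>_def decr_rearr_nonneg)
    show "\<phi> x - \<phi> (2 * x) \<le> K * B" if "0 < x" for x using that B by (intro doubling) auto
    fix \<epsilon> :: real assume "0 < \<epsilon>"
    then have "0 < \<epsilon> / K" using K by simp
    then obtain \<delta> where \<delta>: "0 < \<delta>"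
      "\<And>Q :: (real^'n) set. is_cube Q \<Longrightarrow> measure lebesgue Q \<le> \<delta> \<Longrightarrow> mean_osc f Q \<le> \<epsilon> / K"
      using assms(1) unfolding VMO_iff by blast
    show "\<exists>\<delta>>0. \<forall>x. 0 < x \<and> x < \<delta> \<longrightarrow> \<phi> x - \<phi> (2 * x) \<le> \<epsilon>"
    \<comment> \<open>With 480 x below 1 and \<open>\<delta>\<close>, the cubes in
      \<open>doubling\<close> have volume at most 480 x, hence at most
      \<open>\<delta>\<close>.\<close>
    proof (intro exI[of _ "min 1 \<delta> / 480"] conjI allI impI)
      show "0 < min 1 \<delta> / 480" using \<delta> by simp
      fix x assume x: "0 < x \<and> x < min 1 \<delta> / 480"
      then have "(480 * x) ^ CARD('n) \<le> (480 * x) ^ 1" by (intro power_decreasing) (auto simp: Suc_leI)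
      then have "(480 * x) ^ CARD('n) \<le> \<delta>" using x by simp
      then have "\<phi> x - \<phi> (2 * x) \<le> K * (\<epsilon> / K)" using x \<delta> by (intro doubling) auto
      then show "\<phi> x - \<phi> (2 * x) \<le> \<epsilon>" using K by simp
    qed
  qed
  \<comment> \<open>Both sides take the value 0 at the origin, so they agree everywhere.\<close>
  also have "radial \<phi> = symm_rearr f"
    by (auto simp: radial_def symm_rearr_def \<phi>_def \<omega>_def content_ball)
  finally show ?thesis .
qed

end
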